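(* Let $m:[0,1]\to(0,\infty)$ be monotone and continuous, and suppose that for every sufficiently large $n$ the correlation coefficients of the array satisfy $\rho_{ni}=1-\frac{m(i/n)}{\log n}$ for $1\le i\le n$. For $x<0$, $y<0$ let $$G_n(x,y)=\mathbb{P}\Big(n\big(\max_{1\le i\le n}F_1(X_{ni})-1\big)\le x,\ n\big(\max_{1\le i\le n}F_2(Y_{ni})-1\big)\le y\Big)$$ and $$G(x,y)=\exp\left(x\int_0^1\Phi\left(\sqrt{m(s)}+\frac{\log\frac{x}{y}}{2\sqrt{m(s)}}\right)ds+y\int_0^1\Phi\left(\sqrt{m(s)}+\frac{\log\frac{y}{x}}{2\sqrt{m(s)}}\right)ds\right).$$ Then for any $x<0$ and $y<0$, $$\lim_{n\to\infty}\frac{\log n}{\log\log n}\Big[G_n(x,y)-G(x,y)\Big]=\frac{1}{2\sqrt{2\pi}}\,G(x,y)\int_0^1\sqrt{m(s)}\,\exp\left(-\frac{m(s)-\log(xy)+\frac{(\log(x/y))^2}{4m(s)}}{2}\right)ds.$$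
   Context: $\Phi$ is the standard normal distribution function and $\Phi^{-}$ its inverse. For $\rho\in(-1,1)$ the normal copula $C(\cdot,\cdot;\rho)$ is the distribution function on $(0,1)^2$ with density $$c(u,v;\rho)=\frac{1}{\sqrt{1-\rho^2}}\exp\left(\frac{2\rho\,\Phi^{-}(u)\Phi^{-}(v)-\rho^2(\Phi^{-}(u))^2-\rho^2(\Phi^{-}(v))^2}{2(1-\rho^2)}\right).$$ Setting (dynamic bivariate normal copula): $F_1,F_2$ are continuous distribution functions on the real line. For each (sufficiently large) $n$, $(X_{n1},Y_{n1}),\dots,(X_{nn},Y_{nn})$ are independent bivariate random vectors; for each $i$, $X_{ni}$ has distribution function $F_1$, $Y_{ni}$ has distribution function $F_2$, and the copula of $(X_{ni},Y_{ni})$ is the normal copula $C(\cdot,\cdot;\rho_{ni})$, i.e. $(F_1(X_{ni}),F_2(Y_{ni}))$ has density $c(\cdot,\cdot;\rho_{ni})$. The correlation coefficients $\rho_{ni}$ may depend on both $i$ and $n$; $n$ is taken large enough that $\rho_{ni}\in(-1,1)$. *)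

theory Defs
  imports "HOL-Probability.Probability"
begin

definition Phi :: "real \<Rightarrow> real" where
  "Phi = cdf std_normal_distribution"

(* Only meaningful on {0<..<1}, where it is the inverse function of Phi. *)
definition Phi_inv :: "real \<Rightarrow> real" where
  "Phi_inv = inv Phi"

definition normal_copula_density :: "real \<Rightarrow> real \<Rightarrow> real \<Rightarrow> real" where
  "normal_copula_density r u v =
     1 / sqrt (1 - r\<^sup>2) *
     exp ((2 * r * Phi_inv u * Phi_inv v - r\<^sup>2 * (Phi_inv u)\<^sup>2 - r\<^sup>2 * (Phi_inv v)\<^sup>2)
          / (2 * (1 - r\<^sup>2)))"

definition continuous_distribution_function :: "(real \<Rightarrow> real) \<Rightarrow> bool" where
  "continuous_distribution_function F \<longleftrightarrow>
     (\<exists>D. real_distribution D \<and> F = cdf D) \<and> continuous_on UNIV F"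

(* The copula of (X, Y), whose margins are the continuous distribution functions F1 and F2, is the
   normal copula with parameter r: (F1 X, F2 Y) has the copula density on the open unit square
   (and density 0 outside it). *)
definition has_normal_copula ::
  "'a measure \<Rightarrow> ('a \<Rightarrow> real) \<Rightarrow> ('a \<Rightarrow> real) \<Rightarrow> (real \<Rightarrow> real) \<Rightarrow> (real \<Rightarrow> real) \<Rightarrow> real \<Rightarrow> bool" where
  "has_normal_copula M X Y F1 F2 r \<longleftrightarrow>
     distributed M lborel (\<lambda>\<omega>. (F1 (X \<omega>), F2 (Y \<omega>)))
       (\<lambda>(u, v). ennreal (indicator ({0<..<1} \<times> {0<..<1}) (u, v) * normal_copula_density r u v))"

(* One row of the triangular array: n independent pairs (X i, Y i), 1 <= i <= n, on a
   probability space M, the i-th one having normal copula with correlation r i. *)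
definition normal_copula_row ::
  "nat \<Rightarrow> 'a measure \<Rightarrow> (nat \<Rightarrow> 'a \<Rightarrow> real) \<Rightarrow> (nat \<Rightarrow> 'a \<Rightarrow> real)
     \<Rightarrow> (real \<Rightarrow> real) \<Rightarrow> (real \<Rightarrow> real) \<Rightarrow> (nat \<Rightarrow> real) \<Rightarrow> bool" where
  "normal_copula_row n M X Y F1 F2 r \<longleftrightarrow>
     prob_space M \<and>
     prob_space.indep_vars M (\<lambda>_. borel) (\<lambda>i \<omega>. (X i \<omega>, Y i \<omega>)) {1..n} \<and>
     (\<forall>i\<in>{1..n}. cdf (distr M borel (X i)) = F1 \<and>
                 cdf (distr M borel (Y i)) = F2 \<and>
                 r i \<in> {-1<..<1} \<and>
                 has_normal_copula M (X i) (Y i) F1 F2 (r i))"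

definition maxima_cdf ::
  "nat \<Rightarrow> 'a measure \<Rightarrow> (nat \<Rightarrow> 'a \<Rightarrow> real) \<Rightarrow> (nat \<Rightarrow> 'a \<Rightarrow> real)
     \<Rightarrow> (real \<Rightarrow> real) \<Rightarrow> (real \<Rightarrow> real) \<Rightarrow> real \<Rightarrow> real \<Rightarrow> real" where
  "maxima_cdf n M X Y F1 F2 x y =
     measure M {\<omega> \<in> space M.
       real n * (Max ((\<lambda>i. F1 (X i \<omega>)) ` {1..n}) - 1) \<le> x \<and>
       real n * (Max ((\<lambda>i. F2 (Y i \<omega>)) ` {1..n}) - 1) \<le> y}"

definition limit_cdf :: "(real \<Rightarrow> real) \<Rightarrow> real \<Rightarrow> real \<Rightarrow> real" where
  "limit_cdf m x y =
     exp (x * integral {0..1} (\<lambda>s. Phi (sqrt (m s) + ln (x / y) / (2 * sqrt (m s)))) +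
          y * integral {0..1} (\<lambda>s. Phi (sqrt (m s) + ln (y / x) / (2 * sqrt (m s)))))"

end

theory Submission
  imports Defs "HOL-Real_Asymp.Real_Asymp"
begin

text \<open>
  Write \<open>L = ln n\<close>. The rows are independent, so the distribution function of the maxima is a product
  of values of normal copulas at \<open>(1 + x/n, 1 + y/n)\<close>, and its logarithm is a sum of \<open>n\<close> terms of
  size \<open>1/n\<close>. Everything rests on one expansion, uniform in \<open>\<mu>\<close> over a compact subset of the
  positive reals, of \<open>n ln C\<close> for the single copula value \<open>C\<close> with correlation \<open>r = 1 - \<mu>/L\<close>:
  it equals \<open>V(\<mu>) + (ln L / L) D(\<mu>) + o(ln L / L)\<close>, where \<open>V\<close> is the exponent of the limit and
  \<open>D(\<mu>) = - (\<mu>/2) V'(\<mu>)\<close>. So to second order the dependence parameter \<open>\<mu>\<close> is simply replaced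
  by \<open>\<mu> (1 - ln L / (2 L))\<close>.

  To see this, let \<open>a\<close> and \<open>b\<close> be the normal quantiles of \<open>1 + x/n\<close> and \<open>1 + y/n\<close>, with
  \<open>b \<le> a\<close> by symmetry, and let \<open>\<phi>\<close> be the normal density. Then \<open>1 - C\<close> is \<open>-y/n\<close> plus the
  probability that the first normal variable exceeds \<open>a\<close> while the second stays below \<open>b\<close>. In the
  parameter \<open>\<tau> = sqrt ((1 + r) / (1 - r))\<close> this probability becomes, after one exchange of
  integrals, the single integral of \<open>2 \<phi>(a) \<phi>(((a+b)/\<tau> - (a-b) \<tau>)/2) / (\<tau>\<^sup>2 + 1)\<close> over a half line
  (a version of Plackett's identity). With \<open>\<tau>\<^sup>2\<close> in place of \<open>\<tau>\<^sup>2 + 1\<close> the integrand has an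
  elementary antiderivative, and the replacement costs only a factor between \<open>(1 + r)/2\<close> and \<open>1\<close>,
  a relative error of order \<open>1/L\<close> (\<open>measure_bvn_tail_bounds\<close>). The resulting closed form has
  exactly the shape of the limit (\<open>tail_bound_eq_tail_profile\<close>): the numbers \<open>-x\<close>, \<open>-y\<close> and
  \<open>ln (x/y)\<close> appear perturbed by \<open>O(1/L)\<close> because of Mills' ratio, and \<open>\<mu>\<close> appears multiplied
  by \<open>(a+b)\<^sup>2/(8L)\<close>, up to a factor \<open>1 + O(1/L)\<close>. The quantiles satisfy \<open>a\<^sup>2 = 2 L - ln L + O(1)\<close>, so this last factor is
  \<open>1 - ln L / (2 L) + O(1/L)\<close> (\<open>rate_quantile_sum_square\<close>); it alone is responsible for the
  rate and for the second-order term.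

  Averaging over the row, the sums of \<open>D(m(i/n))\<close> converge to an integral by continuity, while the
  sums of \<open>V(m(i/n))\<close> must approach their integral faster than \<open>ln L / L\<close>. This is where the
  monotonicity of \<open>m\<close> enters: \<open>V\<close> is decreasing, so \<open>V \<circ> m\<close> is monotone and its Riemann sums have
  error \<open>O(1/n)\<close>. Exponentiating gives the theorem.
\<close>

section \<open>The standard normal distribution function\<close>

lemma Phi_diff_eq_integral:
  assumes "s \<le> t"
  shows "Phi t - Phi s = integral {s..t} std_normal_density"
proof (cases "s = t")
  case False
  with assms have st: "s < t" by simp
  interpret D: real_distribution std_normal_distribution by (rule real_dist_normal_dist)
  have "Phi t - Phi s = measure std_normal_distribution {s<..t}"
    unfolding Phi_def by (rule D.cdf_diff_eq[OF st])
  also have "\<dots> = (LINT z|std_normal_distribution. indicator {s<..t} z)"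
    by simp
  also have "\<dots> = (LINT z|lborel. std_normal_density z *\<^sub>R indicator {s<..t} z)"
    by (rule integral_density) auto
  also have "\<dots> = (LINT z:{s..t}|lborel. std_normal_density z)"
    unfolding set_lebesgue_integral_def
    by (rule integral_cong_AE) (use AE_lborel_singleton[of s] in \<open>auto elim!: eventually_mono split: split_indicator\<close>)
  also have "\<dots> = integral {s..t} std_normal_density"
    by (rule set_borel_integral_eq_integral)
      (unfold set_integrable_def, rule integrable_mult_indicator, auto)
  finally show ?thesis .
qed simp

lemma continuous_on_std_normal_density: "continuous_on A std_normal_density"
  unfolding std_normal_density_def by (intro continuous_intros) auto

lemma Phi_has_derivative: "(Phi has_real_derivative std_normal_density x) (at x)"
proof -
  have "((\<lambda>t. integral {x-1..t} std_normal_density) has_real_derivative std_normal_density x)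
          (at x within {x-1..x+1})"
    by (rule integral_has_real_derivative[OF continuous_on_std_normal_density]) auto
  then have "((\<lambda>t. Phi (x-1) + integral {x-1..t} std_normal_density)
          has_real_derivative std_normal_density x) (at x)"
    by (subst (asm) at_within_Icc_at) (auto intro!: derivative_eq_intros)
  then show ?thesis
  proof (rule DERIV_cong_ev[THEN iffD1, rotated -1])
    have "\<forall>\<^sub>F t in nhds x. x - 1 < t"
      by (rule eventually_nhds_in_open[of "{x-1<..}", simplified]) auto
    then show "\<forall>\<^sub>F t in nhds x. Phi (x-1) + integral {x-1..t} std_normal_density = Phi t"
      by eventually_elim (simp add: Phi_diff_eq_integral[symmetric])
  qed auto
qed

lemmas Phi_has_derivative_chain [derivative_intros] = Phi_has_derivative[THEN DERIV_chain2]

lemma isCont_Phi [simp]: "isCont Phi x"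
  using Phi_has_derivative by (rule DERIV_isCont)

lemma tendsto_Phi [tendsto_intros]: "(f \<longlongrightarrow> l) F \<Longrightarrow> ((\<lambda>x. Phi (f x)) \<longlongrightarrow> Phi l) F"
  by (rule isCont_tendsto_compose[OF isCont_Phi])

lemma continuous_on_Phi [continuous_intros]:
  "continuous_on A f \<Longrightarrow> continuous_on A (\<lambda>x. Phi (f x))"
  by (rule continuous_on_compose2[of UNIV Phi]) (auto simp: continuous_on_eq_continuous_at)

lemma borel_measurable_Phi [measurable]: "Phi \<in> borel_measurable borel"
  using continuous_on_Phi[OF continuous_on_id, of UNIV] by (rule borel_measurable_continuous_onI)

lemma Phi_strict_mono: "s < t \<Longrightarrow> Phi s < Phi t"
  by (rule DERIV_pos_imp_increasing) (auto intro!: exI Phi_has_derivative normal_density_pos)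

lemma Phi_less_iff [simp]: "Phi s < Phi t \<longleftrightarrow> s < t"
  by (metis Phi_strict_mono linorder_neqE_linordered_idom order_less_asym order_less_irrefl)

lemma Phi_le_iff [simp]: "Phi s \<le> Phi t \<longleftrightarrow> s \<le> t"
  by (meson Phi_less_iff not_le)

lemma tendsto_Phi_at_top: "(Phi \<longlongrightarrow> 1) at_top"
  unfolding Phi_def by (rule real_distribution.cdf_lim_at_top_prob[OF real_dist_normal_dist])

lemma tendsto_Phi_at_bot: "(Phi \<longlongrightarrow> 0) at_bot"
  unfolding Phi_def
  using real_distribution.finite_borel_measure_M[OF real_dist_normal_dist]
  by (rule finite_borel_measure.cdf_lim_at_bot)

lemma Phi_nonneg [simp]: "0 \<le> Phi x"
  unfolding Phi_def cdf_def by simp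

lemma Phi_pos [simp]: "0 < Phi x"
  by (rule order.strict_trans1[OF Phi_nonneg[of "x - 1"]]) simp

lemma Phi_le_1: "Phi x \<le> 1"
  unfolding Phi_def by (rule real_distribution.cdf_bounded_prob[OF real_dist_normal_dist])

lemma Phi_less_1 [simp]: "Phi x < 1"
  by (rule order.strict_trans2[OF _ Phi_le_1[of "x + 1"]]) simp

lemma Phi_inv_Phi [simp]: "Phi_inv (Phi z) = z"
  unfolding Phi_inv_def by (rule inv_f_f) (simp add: inj_def order_eq_iff)

lemma Phi_surj:
  assumes "0 < u" "u < 1"
  obtains z where "Phi z = u"
proof -
  have "\<forall>\<^sub>F z in at_bot. Phi z < u"
    using tendsto_Phi_at_bot assms(1) by (rule order_tendstoD)
  then obtain s where s: "Phi s < u"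
    by (auto simp: eventually_at_bot_linorder)
  have "\<forall>\<^sub>F z in at_top. u < Phi z"
    using tendsto_Phi_at_top assms(2) by (rule order_tendstoD)
  then obtain t where t: "u < Phi t"
    by (auto simp: eventually_at_top_linorder)
  have "s \<le> t" using s t Phi_le_iff[of s t] by linarith
  then have "\<exists>z\<ge>s. z \<le> t \<and> Phi z = u"
    using s t by (intro IVT) auto
  with that show ?thesis by blast
qed

lemma Phi_Phi_inv: "0 < u \<Longrightarrow> u < 1 \<Longrightarrow> Phi (Phi_inv u) = u"
  by (metis Phi_surj Phi_inv_Phi)

lemma Phi_minus: "Phi (- x) = 1 - Phi x"
proof -
  have "((\<lambda>x. Phi (- x) + Phi x) has_real_derivative 0) (at x)" for x
    by (auto intro!: derivative_eq_intros simp: normal_density_def)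
  then have const: "Phi (- x) + Phi x = Phi (- y) + Phi y" for x y
    using DERIV_isconst_all[of "\<lambda>x. Phi (- x) + Phi x"] by blast
  have "((\<lambda>y. Phi (- y) + Phi y) \<longlongrightarrow> 0 + 1) at_top"
    by (intro tendsto_add tendsto_Phi_at_top
        filterlim_compose[OF tendsto_Phi_at_bot filterlim_uminus_at_bot_at_top])
  then have "((\<lambda>y::real. Phi (- x) + Phi x) \<longlongrightarrow> 1) at_top"
    by (subst (asm) const[of _ x]) simp
  then have "Phi (- x) + Phi x = 1"
    by (simp add: tendsto_const_iff)
  then show ?thesis by simp
qed

lemma std_normal_density_has_derivative [derivative_intros]:
  "(f has_real_derivative f') (at x) \<Longrightarrow>
   ((\<lambda>x. std_normal_density (f x)) has_real_derivative - f x * std_normal_density (f x) * f') (at x)"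
  unfolding std_normal_density_def
  by (rule derivative_eq_intros refl | assumption | simp add: power2_eq_square)+

lemma std_normal_density_at_top: "(std_normal_density \<longlongrightarrow> 0) at_top"
proof -
  have "LIM x at_top. (1/2) * (x::real)\<^sup>2 :> at_top"
    by (intro filterlim_tendsto_pos_mult_at_top[OF tendsto_const] filterlim_pow_at_top filterlim_ident) auto
  then have "((\<lambda>x::real. 1 / sqrt (2 * pi) * exp (- ((1/2) * x\<^sup>2))) \<longlongrightarrow> 1 / sqrt (2 * pi) * 0) at_top"
    by (intro tendsto_mult tendsto_const filterlim_compose[OF exp_at_bot]
        filterlim_compose[OF filterlim_uminus_at_bot_at_top])
  then show ?thesis by (simp add: std_normal_density_def[abs_def])
qed

text \<open>
  Both Mills inequalities follow from this principle: the difference of their two sides vanishes at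
  infinity and has a derivative of constant sign.
\<close>

lemma nonneg_of_antimono_vanishing:
  fixes f :: "real \<Rightarrow> real"
  assumes deriv: "\<And>t. a \<le> t \<Longrightarrow> (f has_real_derivative f' t) (at t)"
    and sign: "\<And>t. a \<le> t \<Longrightarrow> f' t \<le> 0"
    and lim: "(f \<longlongrightarrow> 0) at_top"
  shows "0 \<le> f a"
proof -
  have "\<forall>\<^sub>F t in at_top. f t \<le> f a"
    using eventually_ge_at_top[of a]
  proof eventually_elim
    case (elim t)
    show ?case
      by (rule DERIV_nonpos_imp_nonincreasing[OF elim]) (use deriv sign in blast)
  qed
  from tendsto_upperbound[OF lim this] show ?thesis by simp
qed

lemma Mills_upper:
  assumes "0 < a"
  shows "1 - Phi a \<le> std_normal_density a / a"
proof -
  have "((\<lambda>t. std_normal_density t * inverse t - (1 - Phi t)) \<longlongrightarrow> 0 * 0 - (1 - 1)) at_top"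
    by (intro tendsto_intros std_normal_density_at_top tendsto_Phi_at_top tendsto_inverse_0_at_top filterlim_ident)
  then have "0 \<le> std_normal_density a / a - (1 - Phi a)"
    using assms
    by (intro nonneg_of_antimono_vanishing[where f = "\<lambda>t. std_normal_density t / t - (1 - Phi t)"
          and f' = "\<lambda>t. - std_normal_density t / t\<^sup>2"])
      (auto intro!: derivative_eq_intros simp: field_simps power2_eq_square)
  then show ?thesis by simp
qed

lemma Mills_lower:
  assumes "0 < a"
  shows "std_normal_density a / a * (1 - 1 / a\<^sup>2) \<le> 1 - Phi a"
proof -
  have "((\<lambda>t. 1 - Phi t - std_normal_density t * inverse t * (1 - inverse t * inverse t))
          \<longlongrightarrow> 1 - 1 - 0 * 0 * (1 - 0 * 0)) at_top"
    by (intro tendsto_intros std_normal_density_at_top tendsto_Phi_at_top tendsto_inverse_0_at_top filterlim_ident)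
  then have "0 \<le> 1 - Phi a - std_normal_density a / a * (1 - 1 / a\<^sup>2)"
    using assms
    by (intro nonneg_of_antimono_vanishing[where f = "\<lambda>t. 1 - Phi t - std_normal_density t / t * (1 - 1 / t\<^sup>2)"
          and f' = "\<lambda>t. - 3 * std_normal_density t / t ^ 4"])
      (auto intro!: derivative_eq_intros simp: field_simps power2_eq_square power4_eq_xxxx)
  then show ?thesis by simp
qed

section \<open>From the normal copula to the bivariate normal distribution\<close>

text \<open>
  The probability integral transform. It turns integrals over the copula's unit square into integrals
  against the normal density.
\<close>

lemma distr_Phi_std_normal:
  "distr std_normal_distribution borel Phi = uniform_measure lborel {0<..<1}"
proof (rule cdf_unique)
  interpret N: real_distribution std_normal_distribution by (rule real_dist_normal_dist)
  show "real_distribution (distr std_normal_distribution borel Phi)"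
    by (intro N.real_distribution_distr) simp
  show "real_distribution (uniform_measure lborel {0<..<1})"
    by (intro real_distribution.intro real_distribution_axioms.intro prob_space_uniform_measure) auto
  show "cdf (distr std_normal_distribution borel Phi) = cdf (uniform_measure lborel {0<..<1})"
  proof
    fix u :: real
    have "cdf (distr std_normal_distribution borel Phi) u = N.prob (Phi -` {..u})"
      by (simp add: cdf_def measure_distr)
    moreover have "cdf (uniform_measure lborel {0<..<1}) u = measure lborel ({0<..<1} \<inter> {..u})"
      by (simp add: cdf_def measure_uniform_measure)
    moreover have "N.prob (Phi -` {..u}) = measure lborel ({0<..<1} \<inter> {..u})"
    proof -
      consider "u \<le> 0" | "0 < u" "u < 1" | "1 \<le> u" by linarith
      then show ?thesis
      proof cases
        case 1
        have "u < Phi z" for z using 1 by (rule order.strict_trans1) simp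
        then have "Phi -` {..u} = {}" by (auto dest: leD)
        moreover have "{0<..<1} \<inter> {..u} = {}" using 1 by auto
        ultimately show ?thesis by simp
      next
        case 2
        then obtain z where z: "u = Phi z" using Phi_surj by metis
        have "Phi -` {..u} = {..z}" by (auto simp: z)
        then have "N.prob (Phi -` {..u}) = u" by (simp add: z Phi_def cdf_def)
        moreover have "{0<..<1} \<inter> {..u} = {0<..u}" using 2 by auto
        ultimately show ?thesis using 2 by simp
      next
        case 3
        have "Phi z \<le> u" for z using Phi_le_1 3 by (rule order_trans)
        then have "Phi -` {..u} = UNIV" by auto
        moreover have "{0<..<1} \<inter> {..u} = {0<..<1}" using 3 by auto
        ultimately show ?thesis using N.prob_space by simp
      qed
    qed
    ultimately show "cdf (distr std_normal_distribution borel Phi) u = cdf (uniform_measure lborel {0<..<1}) u"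
      by simp
  qed
qed

lemma nn_integral_Phi_substitution:
  assumes [measurable]: "f \<in> borel_measurable borel"
  shows "(\<integral>\<^sup>+u. f u * indicator {0<..<1} u \<partial>lborel) = (\<integral>\<^sup>+z. ennreal (std_normal_density z) * f (Phi z) \<partial>lborel)"
proof -
  have "(\<integral>\<^sup>+z. ennreal (std_normal_density z) * f (Phi z) \<partial>lborel) = (\<integral>\<^sup>+z. f (Phi z) \<partial>std_normal_distribution)"
    by (subst nn_integral_density) auto
  also have "\<dots> = (\<integral>\<^sup>+u. f u \<partial>distr std_normal_distribution borel Phi)"
    by (subst nn_integral_distr) auto
  also have "\<dots> = (\<integral>\<^sup>+u. f u * indicator {0<..<1} u \<partial>lborel)"
    unfolding distr_Phi_std_normal by (subst nn_integral_uniform_measure) (auto simp: divide_ennreal_def)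
  finally show ?thesis ..
qed

text \<open>
  The density of a standard bivariate normal vector with correlation \<open>r\<close>, written as the law of the
  first coordinate times the conditional law of the second, which is normal with mean \<open>r z1\<close> and
  variance \<open>1 - r\<^sup>2\<close>.
\<close>

definition bvn_density :: "real \<Rightarrow> real \<Rightarrow> real \<Rightarrow> real" where
  "bvn_density r z1 z2 = std_normal_density z1 * normal_density (r * z1) (sqrt (1 - r\<^sup>2)) z2"

definition bvn :: "real \<Rightarrow> (real \<times> real) measure" where
  "bvn r = density lborel (\<lambda>(z1, z2). ennreal (bvn_density r z1 z2))"

definition bvn_cdf :: "real \<Rightarrow> real \<Rightarrow> real \<Rightarrow> real" where
  "bvn_cdf r a b = measure (bvn r) ({..a} \<times> {..b})"

lemma borel_measurable_bvn_density [measurable (raw)]: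
  assumes [measurable]: "f \<in> borel_measurable M" "g \<in> borel_measurable M"
  shows "(\<lambda>x. bvn_density r (f x) (g x)) \<in> borel_measurable M"
  unfolding bvn_density_def normal_density_def by measurable

lemma bvn_density_explicit:
  assumes "r \<in> {-1<..<1}"
  shows "bvn_density r z1 z2 =
    1 / (2 * pi * sqrt (1 - r\<^sup>2)) * exp (- ((z1\<^sup>2 - 2 * r * z1 * z2 + z2\<^sup>2) / (2 * (1 - r\<^sup>2))))"
proof -
  have r: "0 < 1 - r\<^sup>2" using assms by (simp add: abs_square_less_1 abs_less_iff)
  have pre: "1 / sqrt (2 * pi) * (1 / sqrt (2 * pi * (1 - r\<^sup>2))) = 1 / (2 * pi * sqrt (1 - r\<^sup>2))"
    unfolding real_sqrt_mult[of "2 * pi" "1 - r\<^sup>2"] by (simp flip: mult.assoc)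
  have "- z1\<^sup>2 / 2 + - (z2 - r * z1)\<^sup>2 / (2 * (1 - r\<^sup>2)) = - ((z1\<^sup>2 - 2 * r * z1 * z2 + z2\<^sup>2) / (2 * (1 - r\<^sup>2)))"
    using r by (simp add: field_simps power2_eq_square)
  then have "exp (- z1\<^sup>2 / 2) * exp (- (z2 - r * z1)\<^sup>2 / (2 * (1 - r\<^sup>2)))
      = exp (- ((z1\<^sup>2 - 2 * r * z1 * z2 + z2\<^sup>2) / (2 * (1 - r\<^sup>2))))"
    by (simp only: exp_add[symmetric])
  moreover have "bvn_density r z1 z2 = (1 / sqrt (2 * pi) * (1 / sqrt (2 * pi * (1 - r\<^sup>2))))
      * (exp (- z1\<^sup>2 / 2) * exp (- (z2 - r * z1)\<^sup>2 / (2 * (1 - r\<^sup>2))))"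
    using r by (simp add: bvn_density_def normal_density_def)
  ultimately show ?thesis by (simp only: pre)
qed

lemma bvn_density_commute:
  assumes "r \<in> {-1<..<1}"
  shows "bvn_density r z1 z2 = bvn_density r z2 z1"
  using assms by (simp add: bvn_density_explicit algebra_simps)

lemma copula_density_Phi:
  assumes "r \<in> {-1<..<1}"
  shows "std_normal_density z1 * (std_normal_density z2 * normal_copula_density r (Phi z1) (Phi z2))
    = bvn_density r z1 z2"
proof -
  have r: "0 < 1 - r\<^sup>2" using assms by (simp add: abs_square_less_1 abs_less_iff)
  have "- (z1\<^sup>2 / 2) + (- (z2\<^sup>2 / 2) + (2 * r * z1 * z2 - r\<^sup>2 * z1\<^sup>2 - r\<^sup>2 * z2\<^sup>2) / (2 * (1 - r\<^sup>2)))
      = - ((z1\<^sup>2 - 2 * r * z1 * z2 + z2\<^sup>2) / (2 * (1 - r\<^sup>2)))"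
    using r by (simp add: field_simps power2_eq_square)
  then show ?thesis
    unfolding bvn_density_explicit[OF assms] normal_copula_density_def std_normal_density_def
    by (simp add: mult_exp_exp)
qed

lemma emeasure_bvn_iterated:
  assumes [measurable]: "A \<in> sets borel" "B \<in> sets borel"
  shows "emeasure (bvn r) (A \<times> B)
    = (\<integral>\<^sup>+z1. \<integral>\<^sup>+z2. ennreal (bvn_density r z1 z2) * indicator A z1 * indicator B z2 \<partial>lborel \<partial>lborel)"
proof -
  have "emeasure (bvn r) (A \<times> B)
      = (\<integral>\<^sup>+p. (case p of (z1, z2) \<Rightarrow> ennreal (bvn_density r z1 z2) * indicator A z1 * indicator B z2)
           \<partial>(lborel \<Otimes>\<^sub>M lborel))"
    unfolding bvn_def lborel_prod
    by (subst emeasure_density) (auto simp: borel_prod[symmetric] intro!: nn_integral_cong split: split_indicator)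
  also have "\<dots> = (\<integral>\<^sup>+z1. \<integral>\<^sup>+z2. ennreal (bvn_density r z1 z2) * indicator A z1 * indicator B z2 \<partial>lborel \<partial>lborel)"
    by (subst lborel.nn_integral_fst[symmetric]) auto
  finally show ?thesis .
qed

text \<open>
  The margin of the second coordinate is obtained from this symmetry, so that the inner integral always
  runs over a conditional law.
\<close>

lemma emeasure_bvn_commute:
  assumes r: "r \<in> {-1<..<1}" and [measurable]: "A \<in> sets borel" "B \<in> sets borel"
  shows "emeasure (bvn r) (A \<times> B) = emeasure (bvn r) (B \<times> A)"
  unfolding emeasure_bvn_iterated[OF assms(2,3)] emeasure_bvn_iterated[OF assms(3,2)]
  by (subst lborel_pair.Fubini') (auto simp: bvn_density_commute[OF r] mult_ac)

lemma nn_integral_normal_density_atMost: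
  assumes "0 < \<sigma>"
  shows "(\<integral>\<^sup>+z. ennreal (normal_density \<mu> \<sigma> z) * indicator {..b} z \<partial>lborel) = ennreal (Phi ((b - \<mu>) / \<sigma>))"
proof -
  have "(\<integral>\<^sup>+z. ennreal (normal_density \<mu> \<sigma> z) * indicator {..b} z \<partial>lborel)
      = \<sigma> * (\<integral>\<^sup>+z. ennreal (normal_density \<mu> \<sigma> (\<mu> + \<sigma> * z)) * indicator {..b} (\<mu> + \<sigma> * z) \<partial>lborel)"
    using assms by (subst nn_integral_real_affine[where c = \<sigma> and t = \<mu>]) auto
  also have "\<dots> = (\<integral>\<^sup>+z. ennreal (std_normal_density z) * indicator {..(b - \<mu>) / \<sigma>} z \<partial>lborel)"
    using assms
    by (subst nn_integral_cmult[symmetric])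
      (auto intro!: nn_integral_cong split: split_indicator
        simp: normal_density_def field_simps real_sqrt_mult power_mult_distrib ennreal_mult'[symmetric])
  also have "\<dots> = emeasure std_normal_distribution {..(b - \<mu>) / \<sigma>}"
    by (subst emeasure_density) auto
  also have "\<dots> = ennreal (Phi ((b - \<mu>) / \<sigma>))"
    using real_distribution.axioms(1)[OF real_dist_normal_dist]
    by (simp add: Phi_def cdf_def finite_measure.emeasure_eq_measure prob_space_def)
  finally show ?thesis .
qed

lemma emeasure_bvn_atMost_snd:
  assumes r: "r \<in> {-1<..<1}" and [measurable]: "A \<in> sets borel"
  shows "emeasure (bvn r) (A \<times> {..b})
    = (\<integral>\<^sup>+z. ennreal (std_normal_density z) * ennreal (Phi ((b - r * z) / sqrt (1 - r\<^sup>2))) * indicator A z \<partial>lborel)"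
proof -
  have pos: "0 < sqrt (1 - r\<^sup>2)" using r by (simp add: abs_square_less_1 abs_less_iff)
  have "emeasure (bvn r) (A \<times> {..b}) = (\<integral>\<^sup>+z. ennreal (std_normal_density z) * indicator A z *
      (\<integral>\<^sup>+z2. ennreal (normal_density (r * z) (sqrt (1 - r\<^sup>2)) z2) * indicator {..b} z2 \<partial>lborel) \<partial>lborel)"
    by (subst emeasure_bvn_iterated)
      (auto simp: bvn_density_def ennreal_mult' mult_ac intro!: nn_integral_cong simp flip: nn_integral_cmult)
  then show ?thesis
    by (simp only: nn_integral_normal_density_atMost[OF pos]) (simp add: mult_ac)
qed

lemma emeasure_bvn_fst:
  assumes r: "r \<in> {-1<..<1}"
  shows "emeasure (bvn r) ({..b} \<times> UNIV) = ennreal (Phi b)"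
proof -
  have pos: "0 < sqrt (1 - r\<^sup>2)" using r by (simp add: abs_square_less_1 abs_less_iff)
  have one: "(\<integral>\<^sup>+z2. ennreal (normal_density m (sqrt (1 - r\<^sup>2)) z2) \<partial>lborel) = 1" for m
    using pos by (subst nn_integral_eq_integral) auto
  have "emeasure (bvn r) ({..b} \<times> UNIV) = (\<integral>\<^sup>+z. ennreal (std_normal_density z) * indicator {..b} z *
      (\<integral>\<^sup>+z2. ennreal (normal_density (r * z) (sqrt (1 - r\<^sup>2)) z2) \<partial>lborel) \<partial>lborel)"
    by (subst emeasure_bvn_iterated)
      (auto simp: bvn_density_def ennreal_mult' mult_ac intro!: nn_integral_cong simp flip: nn_integral_cmult)
  also have "\<dots> = ennreal (Phi b)"
    using nn_integral_normal_density_atMost[of 1 0 b] by (simp add: one)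
  finally show ?thesis .
qed

lemma bvn_cdf_commute: "r \<in> {-1<..<1} \<Longrightarrow> bvn_cdf r a b = bvn_cdf r b a"
  unfolding bvn_cdf_def measure_def by (subst emeasure_bvn_commute) auto

text \<open>
  The asymmetric decomposition that suits the tail estimate: since the margin at \<open>b\<close> is explicit, only
  the probability of exceeding \<open>a\<close> while staying below \<open>b\<close> has to be understood.
\<close>

lemma bvn_cdf_eq_margin_minus_tail:
  assumes r: "r \<in> {-1<..<1}"
  shows "bvn_cdf r a b = Phi b - measure (bvn r) ({a<..} \<times> {..b})"
    and "emeasure (bvn r) ({a<..} \<times> {..b}) \<noteq> \<infinity>"
proof -
  have UN: "emeasure (bvn r) (UNIV \<times> {..b}) = ennreal (Phi b)"
    by (subst emeasure_bvn_commute[OF r]) (auto simp: emeasure_bvn_fst[OF r])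
  have sets [measurable, simp]: "sets (bvn r) = sets (borel \<Otimes>\<^sub>M borel)"
    unfolding bvn_def borel_prod by simp
  have fin: "emeasure (bvn r) (S \<times> {..b}) \<noteq> \<infinity>" if "S \<in> sets borel" for S
  proof -
    have "emeasure (bvn r) (S \<times> {..b}) \<le> emeasure (bvn r) (UNIV \<times> {..b})"
      using that by (intro emeasure_mono) auto
    then show ?thesis unfolding UN by (auto simp: top_unique)
  qed
  then show "emeasure (bvn r) ({a<..} \<times> {..b}) \<noteq> \<infinity>" by simp
  have "UNIV \<times> {..b} = ({..a} \<times> {..b}) \<union> ({a<..} \<times> {..b})" by auto
  then have "measure (bvn r) (UNIV \<times> {..b}) = measure (bvn r) ({..a} \<times> {..b}) + measure (bvn r) ({a<..} \<times> {..b})"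
    using fin by (simp only:) (rule measure_Union, auto)
  moreover have "measure (bvn r) (UNIV \<times> {..b}) = Phi b"
    by (simp add: measure_def UN)
  ultimately show "bvn_cdf r a b = Phi b - measure (bvn r) ({a<..} \<times> {..b})"
    by (simp add: bvn_cdf_def)
qed

lemma prob_normal_copula:
  assumes cop: "has_normal_copula M X Y F1 F2 r" and r: "r \<in> {-1<..<1}"
  shows "measure M {\<omega> \<in> space M. F1 (X \<omega>) \<le> Phi a \<and> F2 (Y \<omega>) \<le> Phi b} = bvn_cdf r a b"
proof -
  define g where "g = (\<lambda>(u, v). ennreal (indicator ({0<..<1} \<times> {0<..<1}) (u, v) * normal_copula_density r u v))"
  have D: "distributed M lborel (\<lambda>\<omega>. (F1 (X \<omega>), F2 (Y \<omega>))) g"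
    using cop unfolding has_normal_copula_def g_def .
  have g [measurable]: "g \<in> borel_measurable (lborel \<Otimes>\<^sub>M lborel)"
    using distributed_borel_measurable[OF D] by (simp add: lborel_prod)
  let ?h = "\<lambda>u v. g (u, v) * (indicator {..Phi a} u * indicator {..Phi b} v)"
  have gPhi: "ennreal (std_normal_density z1) * (ennreal (std_normal_density z2) * g (Phi z1, Phi z2))
      = ennreal (bvn_density r z1 z2)" for z1 z2
    by (simp add: g_def copula_density_Phi[OF r, symmetric] ennreal_mult')
  \<comment> \<open>The density vanishes off the open unit square, which is the range of \<open>(Phi, Phi)\<close>; both integrals can then be substituted.\<close>
  have g0: "g (u, v) = g (u, v) * indicator {0<..<1} u * indicator {0<..<1} v" for u v
    by (auto simp: g_def split: split_indicator)
  have "emeasure M {\<omega> \<in> space M. F1 (X \<omega>) \<le> Phi a \<and> F2 (Y \<omega>) \<le> Phi b}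
      = emeasure M ((\<lambda>\<omega>. (F1 (X \<omega>), F2 (Y \<omega>))) -` ({..Phi a} \<times> {..Phi b}) \<inter> space M)"
    by (rule arg_cong[where f = "emeasure M"]) auto
  also have "\<dots> = (\<integral>\<^sup>+p. g p * indicator ({..Phi a} \<times> {..Phi b}) p \<partial>lborel)"
    by (rule distributed_emeasure[OF D]) (simp add: borel_prod[symmetric])
  also have "\<dots> = (\<integral>\<^sup>+p. (case p of (u, v) \<Rightarrow> ?h u v) \<partial>(lborel \<Otimes>\<^sub>M lborel))"
    unfolding lborel_prod by (intro nn_integral_cong) (auto simp: indicator_times)
  also have "\<dots> = (\<integral>\<^sup>+u. \<integral>\<^sup>+v. ?h u v \<partial>lborel \<partial>lborel)"
    by (subst lborel.nn_integral_fst[symmetric]) auto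
  also have "\<dots> = (\<integral>\<^sup>+u. (\<integral>\<^sup>+v. ?h u v * indicator {0<..<1} v \<partial>lborel) * indicator {0<..<1} u \<partial>lborel)"
    by (intro nn_integral_cong, subst g0, subst nn_integral_multc[symmetric])
       (auto intro!: nn_integral_cong split: split_indicator)
  also have "\<dots> = (\<integral>\<^sup>+u. (\<integral>\<^sup>+z2. ennreal (std_normal_density z2) * ?h u (Phi z2) \<partial>lborel) * indicator {0<..<1} u \<partial>lborel)"
    by (subst nn_integral_Phi_substitution) auto
  also have "\<dots> = (\<integral>\<^sup>+z1. ennreal (std_normal_density z1) *
      (\<integral>\<^sup>+z2. ennreal (std_normal_density z2) * ?h (Phi z1) (Phi z2) \<partial>lborel) \<partial>lborel)"
    by (subst nn_integral_Phi_substitution) auto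
  also have "\<dots> = (\<integral>\<^sup>+z1. \<integral>\<^sup>+z2. ennreal (bvn_density r z1 z2) * indicator {..a} z1 * indicator {..b} z2 \<partial>lborel \<partial>lborel)"
    by (auto simp: nn_integral_cmult[symmetric] gPhi[symmetric] mult_ac split: split_indicator intro!: nn_integral_cong)
  also have "\<dots> = emeasure (bvn r) ({..a} \<times> {..b})"
    by (rule emeasure_bvn_iterated[symmetric]) auto
  finally show ?thesis
    unfolding bvn_cdf_def measure_def by simp
qed

section \<open>Closed-form bounds for the bivariate tail\<close>

lemma nn_integral_atLeast_eq_greaterThan:
  fixes f :: "real \<Rightarrow> ennreal"
  shows "(\<integral>\<^sup>+z. f z * indicator {a<..} z \<partial>lborel) = (\<integral>\<^sup>+z. f z * indicator {a..} z \<partial>lborel)"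
  by (rule nn_integral_cong_AE) (use AE_lborel_singleton[of a] in \<open>auto elim!: eventually_mono split: split_indicator\<close>)

text \<open>
  The point of the parameter \<open>\<tau> = sqrt ((1 + r) / (1 - r))\<close>: the standardized conditional bound becomes
  a Laurent polynomial in \<open>\<tau>\<close>, and perfect dependence \<open>r = 1\<close> corresponds to \<open>\<tau> = \<infinity>\<close>, where the
  conditional probability vanishes.
\<close>

lemma standardized_bound_eq:
  assumes r: "r \<in> {-1<..<1}"
  defines "\<tau> \<equiv> sqrt ((1 + r) / (1 - r))"
  shows "(b - r * z) / sqrt (1 - r\<^sup>2) = ((b + z) / \<tau> - (z - b) * \<tau>) / 2"
proof -
  define P Q where "P = sqrt (1 + r)" and "Q = sqrt (1 - r)"
  have pos: "0 < P" "0 < Q" using r by (auto simp: P_def Q_def)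
  have sq: "P\<^sup>2 = 1 + r" "Q\<^sup>2 = 1 - r" using r by (auto simp: P_def Q_def)
  have root: "sqrt (1 - r\<^sup>2) = P * Q"
    unfolding P_def Q_def real_sqrt_mult[symmetric] by (simp add: algebra_simps power2_eq_square)
  have "\<tau> = P / Q" by (simp add: \<tau>_def P_def Q_def real_sqrt_divide)
  have "((b + z) / \<tau> - (z - b) * \<tau>) / 2 = ((b + z) * Q\<^sup>2 - (z - b) * P\<^sup>2) / (2 * (P * Q))"
    unfolding \<open>\<tau> = P / Q\<close> using pos by (simp add: field_simps power2_eq_square)
  also have "(b + z) * Q\<^sup>2 - (z - b) * P\<^sup>2 = 2 * (b - r * z)"
    unfolding sq by (simp add: algebra_simps)
  also have "2 * (b - r * z) / (2 * (P * Q)) = (b - r * z) / (P * Q)"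
    by (rule mult_divide_mult_cancel_left) simp
  finally show ?thesis unfolding root by (rule sym)
qed

lemma std_normal_density_le_1: "std_normal_density z \<le> 1"
proof -
  have "1 \<le> sqrt (2 * pi)" using pi_gt3 by simp
  then have "1 / sqrt (2 * pi) \<le> 1" by simp
  moreover have "exp (- z\<^sup>2 / 2) \<le> 1" by simp
  ultimately show ?thesis
    unfolding std_normal_density_def by (intro mult_le_one) auto
qed

text \<open>
  The kernel is minus the derivative in \<open>\<tau>\<close> of the conditional distribution function. Multiplied by the
  density of \<open>z\<close> it is also an exact derivative in \<open>z\<close>, namely that of \<open>- 2 / (\<tau>\<^sup>2 + 1)\<close> times the
  product of the two densities; this is why exchanging the two integrals leaves a single one.
\<close>

lemma nn_integral_tail_kernel:
  assumes "0 < \<tau>" "0 < b" "b \<le> a"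
  shows "(\<integral>\<^sup>+z. ennreal (std_normal_density z * std_normal_density (((b + z) / \<tau> - (z - b) * \<tau>) / 2)
            * (((z - b) + (z + b) / \<tau>\<^sup>2) / 2)) * indicator {a..} z \<partial>lborel)
       = ennreal (2 / (\<tau>\<^sup>2 + 1) * std_normal_density a * std_normal_density (((a + b) / \<tau> - (a - b) * \<tau>) / 2))"
proof -
  let ?g = "\<lambda>z. ((b + z) / \<tau> - (z - b) * \<tau>) / 2"
  let ?F = "\<lambda>z. - (2 / (\<tau>\<^sup>2 + 1) * (std_normal_density z * std_normal_density (?g z)))"
  have t1: "\<tau>\<^sup>2 + 1 > 0" by (simp add: add_nonneg_pos)
  have "((\<lambda>z. std_normal_density z * std_normal_density (?g z)) \<longlongrightarrow> 0) at_top"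
  proof (rule tendsto_sandwich[OF _ _ tendsto_const std_normal_density_at_top])
    show "\<forall>\<^sub>F z in at_top. std_normal_density z * std_normal_density (?g z) \<le> std_normal_density z"
      using std_normal_density_le_1 by (intro always_eventually allI mult_left_le) auto
  qed auto
  then have lim: "(?F \<longlongrightarrow> - (2 / (\<tau>\<^sup>2 + 1) * 0)) at_top"
    by (intro tendsto_intros)
  have deriv: "(?F has_real_derivative (std_normal_density z * std_normal_density (?g z)
            * (((z - b) + (z + b) / \<tau>\<^sup>2) / 2))) (at z)" for z
  proof -
    \<comment> \<open>The logarithmic derivative in \<open>z\<close> of the product of densities is a multiple of the kernel.\<close>
    have key: "z + ?g z * ((1 / \<tau> - \<tau>) / 2) = ((z - b) + (z + b) / \<tau>\<^sup>2) / 2 * ((\<tau>\<^sup>2 + 1) / 2)"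
      using assms(1) by (simp add: field_simps power2_eq_square)
    have "(?F has_real_derivative (2 / (\<tau>\<^sup>2 + 1) * (std_normal_density z * std_normal_density (?g z)
           * (z + ?g z * ((1 / \<tau> - \<tau>) / 2))))) (at z)"
    proof -
      have g: "(?g has_real_derivative (1 / \<tau> - \<tau>) / 2) (at z)"
        using assms(1) by (auto intro!: derivative_eq_intros simp: field_simps)
      have "(?F has_real_derivative - (2 / (\<tau>\<^sup>2 + 1) * ((- z * std_normal_density z * 1) * std_normal_density (?g z)
          + (- ?g z * std_normal_density (?g z) * ((1 / \<tau> - \<tau>) / 2)) * std_normal_density z))) (at z)"
        by (intro DERIV_minus DERIV_cmult DERIV_mult std_normal_density_has_derivative g DERIV_ident)
      also have "- (2 / (\<tau>\<^sup>2 + 1) * ((- z * std_normal_density z * 1) * std_normal_density (?g z)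
          + (- ?g z * std_normal_density (?g z) * ((1 / \<tau> - \<tau>) / 2)) * std_normal_density z))
        = 2 / (\<tau>\<^sup>2 + 1) * (std_normal_density z * std_normal_density (?g z)
           * (z + ?g z * ((1 / \<tau> - \<tau>) / 2)))"
        by (simp only: mult_minus_left mult_minus_right minus_add_distrib minus_minus distrib_left mult_1_right mult_ac)
      finally show ?thesis .
    qed
    also have "2 / (\<tau>\<^sup>2 + 1) * (std_normal_density z * std_normal_density (?g z)
           * (z + ?g z * ((1 / \<tau> - \<tau>) / 2))) = std_normal_density z * std_normal_density (?g z)
            * (((z - b) + (z + b) / \<tau>\<^sup>2) / 2)"
      unfolding key using t1 by (simp add: field_simps)
    finally show ?thesis .
  qed
  have "(\<integral>\<^sup>+z. ennreal (std_normal_density z * std_normal_density (?g z)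
            * (((z - b) + (z + b) / \<tau>\<^sup>2) / 2)) * indicator {a..} z \<partial>lborel) = ennreal (0 - ?F a)"
    by (rule nn_integral_FTC_atLeast[OF _ deriv]) (use assms lim in auto)
  then show ?thesis by (simp add: mult_ac add_ac)
qed

lemma Phi_eq_nn_integral_kernel:
  assumes "0 < \<tau>\<^sub>0" "0 < b" "b < z"
  shows "ennreal (Phi (((b + z) / \<tau>\<^sub>0 - (z - b) * \<tau>\<^sub>0) / 2))
    = (\<integral>\<^sup>+\<tau>. ennreal (std_normal_density (((b + z) / \<tau> - (z - b) * \<tau>) / 2)
            * (((z - b) + (z + b) / \<tau>\<^sup>2) / 2)) * indicator {\<tau>\<^sub>0..} \<tau> \<partial>lborel)"
proof -
  let ?g = "\<lambda>\<tau>. ((b + z) / \<tau> - (z - b) * \<tau>) / 2"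
  let ?F = "\<lambda>\<tau>. - Phi (?g \<tau>)"
  have deriv: "(?F has_real_derivative (std_normal_density (?g \<tau>)
            * (((z - b) + (z + b) / \<tau>\<^sup>2) / 2))) (at \<tau>)" if "\<tau>\<^sub>0 \<le> \<tau>" for \<tau>
    using that assms(1) by (auto intro!: derivative_eq_intros simp: field_simps power2_eq_square)
  have "LIM \<tau> at_top. - ((b + z) / \<tau> / 2) + (z - b) * \<tau> / 2 :> at_top"
  proof (rule filterlim_tendsto_add_at_top)
    show "LIM \<tau> at_top. (z - b) * \<tau> / 2 :> at_top"
      using filterlim_tendsto_pos_mult_at_top[OF tendsto_const[of "(z-b)/2"] _ filterlim_ident] assms by simp
    show "((\<lambda>\<tau>. - ((b + z) / \<tau> / 2)) \<longlongrightarrow> - (0 / 2)) at_top"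
      by (intro tendsto_intros tendsto_divide_0[OF tendsto_const] filterlim_at_top_imp_at_infinity filterlim_ident) auto
  qed
  moreover have "(\<lambda>\<tau>. - ?g \<tau>) = (\<lambda>\<tau>. - ((b + z) / \<tau> / 2) + (z - b) * \<tau> / 2)"
    by (simp add: diff_divide_distrib)
  ultimately have "LIM \<tau> at_top. ?g \<tau> :> at_bot"
    unfolding filterlim_uminus_at_bot by simp
  then have lim: "(?F \<longlongrightarrow> - 0) at_top"
    by (intro tendsto_minus filterlim_compose[OF tendsto_Phi_at_bot])
  have "(\<integral>\<^sup>+\<tau>. ennreal (std_normal_density (?g \<tau>)
            * (((z - b) + (z + b) / \<tau>\<^sup>2) / 2)) * indicator {\<tau>\<^sub>0..} \<tau> \<partial>lborel) = ennreal (0 - ?F \<tau>\<^sub>0)"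
    by (rule nn_integral_FTC_atLeast[OF _ deriv]) (use assms lim in auto)
  then show ?thesis by simp
qed

text \<open>
  The closed form that results when \<open>\<tau>\<^sup>2 + 1\<close> is replaced by \<open>\<tau>\<^sup>2\<close> in the integral for the tail
  probability.
\<close>

definition tail_bound :: "real \<Rightarrow> real \<Rightarrow> real \<Rightarrow> real" where
  "tail_bound a b \<tau> = 2 / (a + b) *
     (std_normal_density a * Phi (((a + b) / \<tau> - (a - b) * \<tau>) / 2)
      - std_normal_density b * Phi (- (((a + b) / \<tau> + (a - b) * \<tau>) / 2)))"

text \<open>
  The two normal distribution functions in \<open>tail_bound\<close> have derivatives whose densities, weighted by
  \<open>std_normal_density a\<close> and \<open>std_normal_density b\<close>, coincide, because
  \<open>b\<^sup>2 + (u + v)\<^sup>2 = a\<^sup>2 + (u - v)\<^sup>2\<close> when \<open>u = (a + b) / (2 \<tau>)\<close> and \<open>v = (a - b) \<tau> / 2\<close>. In the difference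
  the contributions of the derivative of \<open>v\<close> cancel and those of the derivative of \<open>u\<close> add up to the integrand.
\<close>

lemma tail_bound_integral:
  assumes "0 < \<tau>\<^sub>0" "0 < b" "b \<le> a"
  shows "(\<integral>\<^sup>+\<tau>. ennreal (2 / \<tau>\<^sup>2 * std_normal_density a * std_normal_density (((a + b) / \<tau> - (a - b) * \<tau>) / 2))
            * indicator {\<tau>\<^sub>0..} \<tau> \<partial>lborel) = ennreal (tail_bound a b \<tau>\<^sub>0)"
    and "0 \<le> tail_bound a b \<tau>\<^sub>0"
proof -
  let ?p = "\<lambda>\<tau>. ((a + b) / \<tau> - (a - b) * \<tau>) / 2" and ?q = "\<lambda>\<tau>. - (((a + b) / \<tau> + (a - b) * \<tau>) / 2)"
  have ab: "a + b > 0" using assms by simp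
  have same: "std_normal_density b * std_normal_density (?q \<tau>) = std_normal_density a * std_normal_density (?p \<tau>)"
    if "0 < \<tau>" for \<tau>
  proof -
    have "b\<^sup>2 + (?q \<tau>)\<^sup>2 = a\<^sup>2 + (?p \<tau>)\<^sup>2"
      using that by (simp add: field_simps power2_eq_square)
    then have "exp (- b\<^sup>2 / 2) * exp (- (?q \<tau>)\<^sup>2 / 2) = exp (- a\<^sup>2 / 2) * exp (- (?p \<tau>)\<^sup>2 / 2)"
      unfolding exp_add[symmetric] by (intro arg_cong[where f = exp]) argo
    then show ?thesis by (simp add: std_normal_density_def)
  qed
  have deriv: "((\<lambda>\<tau>. - tail_bound a b \<tau>) has_real_derivative
      (2 / \<tau>\<^sup>2 * std_normal_density a * std_normal_density (?p \<tau>))) (at \<tau>)" if "\<tau>\<^sub>0 \<le> \<tau>" for \<tau>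
  proof -
    have \<tau>: "0 < \<tau>" using that assms by simp
    define e where "e = std_normal_density a * std_normal_density (?p \<tau>)"
    have collect: "e * ((s - d) / 2) - e * (- ((s + d) / 2)) = e * s" for s d
      by (simp add: field_simps)
    have p: "(?p has_real_derivative ((- (a + b) / \<tau>\<^sup>2 - (a - b)) / 2)) (at \<tau>)"
      and q: "(?q has_real_derivative (- ((- (a + b) / \<tau>\<^sup>2 + (a - b)) / 2))) (at \<tau>)"
      using \<tau> by (auto intro!: derivative_eq_intros simp: power2_eq_square)
    have "((\<lambda>\<tau>. - tail_bound a b \<tau>) has_real_derivative
       - (2 / (a + b) * (std_normal_density a * (std_normal_density (?p \<tau>) * ((- (a + b) / \<tau>\<^sup>2 - (a - b)) / 2))
         - std_normal_density b * (std_normal_density (?q \<tau>) * (- ((- (a + b) / \<tau>\<^sup>2 + (a - b)) / 2)))))) (at \<tau>)"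
      unfolding tail_bound_def
      by (intro DERIV_minus DERIV_cmult DERIV_diff Phi_has_derivative_chain p q)
    also have "- (2 / (a + b) * (std_normal_density a * (std_normal_density (?p \<tau>) * ((- (a + b) / \<tau>\<^sup>2 - (a - b)) / 2))
         - std_normal_density b * (std_normal_density (?q \<tau>) * (- ((- (a + b) / \<tau>\<^sup>2 + (a - b)) / 2)))))
       = - (2 / (a + b) * (e * ((- (a + b) / \<tau>\<^sup>2 - (a - b)) / 2) - e * (- ((- (a + b) / \<tau>\<^sup>2 + (a - b)) / 2))))"
      using same[OF \<tau>] by (simp add: e_def mult.assoc[symmetric])
    also have "\<dots> = - (2 / (a + b) * (e * (- (a + b) / \<tau>\<^sup>2)))"
      by (simp only: collect)
    also have "\<dots> = 2 / \<tau>\<^sup>2 * e"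
      using ab by (simp add: divide_simps) (simp add: algebra_simps)
    finally show ?thesis by (simp add: e_def mult.assoc)
  qed
  have frac0: "((\<lambda>\<tau>. (a + b) / \<tau>) \<longlongrightarrow> 0) at_top"
    by (intro tendsto_divide_0[OF tendsto_const] filterlim_at_top_imp_at_infinity filterlim_ident)
  \<comment> \<open>For \<open>a > b\<close> both arguments tend to minus infinity; for \<open>a = b\<close> both tend to 0 and the two terms cancel.\<close>
  have lim0: "(tail_bound a b \<longlongrightarrow> 0) at_top"
  proof (cases "a = b")
    case True
    have "(tail_bound a b \<longlongrightarrow> 2 / (a + b) * (std_normal_density a * Phi ((0 - 0) / 2)
      - std_normal_density b * Phi (- ((0 + 0) / 2)))) at_top"
      unfolding tail_bound_def using True frac0 by (intro tendsto_intros) auto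
    then show ?thesis using True by simp
  next
    case False
    then have "a - b > 0" using assms by simp
    then have lin: "LIM \<tau> at_top. (a - b) * \<tau> / 2 :> at_top"
      using filterlim_tendsto_pos_mult_at_top[OF tendsto_const[of "(a-b)/2"] _ filterlim_ident] by simp
    have frac: "((\<lambda>\<tau>. c * ((a + b) / \<tau>)) \<longlongrightarrow> c * 0) at_top" for c
      by (intro tendsto_intros frac0)
    have "(\<lambda>\<tau>. -1/2 * ((a + b) / \<tau>) + (a - b) * \<tau> / 2) = (\<lambda>\<tau>. - ?p \<tau>)"
      by (rule ext) (simp add: diff_divide_distrib add_divide_distrib)
    then have p: "LIM \<tau> at_top. ?p \<tau> :> at_bot"
      using filterlim_tendsto_add_at_top[OF frac[of "-1/2"] lin]
      unfolding filterlim_uminus_at_bot by simp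
    have "(\<lambda>\<tau>. 1/2 * ((a + b) / \<tau>) + (a - b) * \<tau> / 2) = (\<lambda>\<tau>. - ?q \<tau>)"
      by (rule ext) (simp add: diff_divide_distrib add_divide_distrib)
    then have q: "LIM \<tau> at_top. ?q \<tau> :> at_bot"
      using filterlim_tendsto_add_at_top[OF frac[of "1/2"] lin]
      unfolding filterlim_uminus_at_bot by simp
    have "(tail_bound a b \<longlongrightarrow> 2 / (a + b) * (std_normal_density a * 0 - std_normal_density b * 0)) at_top"
      unfolding tail_bound_def
      by (intro tendsto_intros filterlim_compose[OF tendsto_Phi_at_bot] p q)
    then show ?thesis by simp
  qed
  have lim: "((\<lambda>\<tau>. - tail_bound a b \<tau>) \<longlongrightarrow> - 0) at_top"
    by (rule tendsto_minus[OF lim0])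
  show "0 \<le> tail_bound a b \<tau>\<^sub>0"
    by (rule nonneg_of_antimono_vanishing[OF DERIV_minus[OF deriv, unfolded minus_minus]]) (use lim0 in auto)
  have "(\<integral>\<^sup>+\<tau>. ennreal (2 / \<tau>\<^sup>2 * std_normal_density a * std_normal_density (?p \<tau>))
            * indicator {\<tau>\<^sub>0..} \<tau> \<partial>lborel) = ennreal (0 - (- tail_bound a b \<tau>\<^sub>0))"
    by (rule nn_integral_FTC_atLeast[OF _ deriv]) (use assms lim in auto)
  then show "(\<integral>\<^sup>+\<tau>. ennreal (2 / \<tau>\<^sup>2 * std_normal_density a * std_normal_density (?p \<tau>))
            * indicator {\<tau>\<^sub>0..} \<tau> \<partial>lborel) = ennreal (tail_bound a b \<tau>\<^sub>0)"
    by simp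
qed

text \<open>
  Plackett's identity, integrated from perfect dependence down to correlation \<open>r\<close>. The ordering of \<open>a\<close> and \<open>b\<close>
  makes the kernel nonnegative, so that Tonelli's theorem applies.
\<close>

lemma emeasure_bvn_tail_eq:
  assumes r: "r \<in> {-1<..<1}" and ab: "0 < b" "b \<le> a"
  defines "\<tau>\<^sub>0 \<equiv> sqrt ((1 + r) / (1 - r))"
  shows "emeasure (bvn r) ({a<..} \<times> {..b})
    = (\<integral>\<^sup>+\<tau>. ennreal (2 / (\<tau>\<^sup>2 + 1) * std_normal_density a * std_normal_density (((a + b) / \<tau> - (a - b) * \<tau>) / 2))
            * indicator {\<tau>\<^sub>0..} \<tau> \<partial>lborel)"
proof -
  have \<tau>\<^sub>0: "0 < \<tau>\<^sub>0" using r by (simp add: \<tau>\<^sub>0_def)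
  let ?k = "\<lambda>z \<tau>. std_normal_density (((b + z) / \<tau> - (z - b) * \<tau>) / 2) * (((z - b) + (z + b) / \<tau>\<^sup>2) / 2)"
  have "emeasure (bvn r) ({a<..} \<times> {..b})
    = (\<integral>\<^sup>+z. ennreal (std_normal_density z) * ennreal (Phi (((b + z) / \<tau>\<^sub>0 - (z - b) * \<tau>\<^sub>0) / 2)) * indicator {a<..} z \<partial>lborel)"
    unfolding \<tau>\<^sub>0_def standardized_bound_eq[OF r, symmetric] by (rule emeasure_bvn_atMost_snd[OF r]) simp
  also have "\<dots> = (\<integral>\<^sup>+z. \<integral>\<^sup>+\<tau>. ennreal (std_normal_density z * ?k z \<tau>) * indicator {\<tau>\<^sub>0..} \<tau> * indicator {a<..} z \<partial>lborel \<partial>lborel)"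
  proof (rule nn_integral_cong)
    fix z :: real
    show "ennreal (std_normal_density z) * ennreal (Phi (((b + z) / \<tau>\<^sub>0 - (z - b) * \<tau>\<^sub>0) / 2)) * indicator {a<..} z
       = (\<integral>\<^sup>+\<tau>. ennreal (std_normal_density z * ?k z \<tau>) * indicator {\<tau>\<^sub>0..} \<tau> * indicator {a<..} z \<partial>lborel)"
    proof (cases "a < z")
      case True
      then have "b < z" using ab by simp
      have "ennreal (std_normal_density z) * ennreal (Phi (((b + z) / \<tau>\<^sub>0 - (z - b) * \<tau>\<^sub>0) / 2))
          = (\<integral>\<^sup>+\<tau>. ennreal (std_normal_density z) * (ennreal (?k z \<tau>) * indicator {\<tau>\<^sub>0..} \<tau>) \<partial>lborel)"
        unfolding Phi_eq_nn_integral_kernel[OF \<tau>\<^sub>0 ab(1) \<open>b < z\<close>] by (rule nn_integral_cmult[symmetric]) measurable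
      also have "\<dots> = (\<integral>\<^sup>+\<tau>. ennreal (std_normal_density z * ?k z \<tau>) * indicator {\<tau>\<^sub>0..} \<tau> \<partial>lborel)"
        by (simp only: ennreal_mult'[OF normal_density_nonneg] mult.assoc)
      finally show ?thesis using True by simp
    qed auto
  qed
  also have "\<dots> = (\<integral>\<^sup>+\<tau>. \<integral>\<^sup>+z. ennreal (std_normal_density z * ?k z \<tau>) * indicator {\<tau>\<^sub>0..} \<tau> * indicator {a<..} z \<partial>lborel \<partial>lborel)"
    by (rule lborel_pair.Fubini') measurable
  also have "\<dots> = (\<integral>\<^sup>+\<tau>. (\<integral>\<^sup>+z. ennreal (std_normal_density z * ?k z \<tau>) * indicator {a..} z \<partial>lborel) * indicator {\<tau>\<^sub>0..} \<tau> \<partial>lborel)"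
    by (subst nn_integral_atLeast_eq_greaterThan[symmetric], subst nn_integral_multc[symmetric])
      (auto intro!: nn_integral_cong split: split_indicator)
  also have "\<dots> = (\<integral>\<^sup>+\<tau>. ennreal (2 / (\<tau>\<^sup>2 + 1) * std_normal_density a * std_normal_density (((a + b) / \<tau> - (a - b) * \<tau>) / 2))
            * indicator {\<tau>\<^sub>0..} \<tau> \<partial>lborel)"
    using \<tau>\<^sub>0 nn_integral_tail_kernel[OF _ ab]
    by (intro nn_integral_cong) (auto simp: mult.assoc split: split_indicator)
  finally show ?thesis .
qed

text \<open>
  For \<open>\<tau> \<ge> \<tau>\<^sub>0\<close> the ratio of \<open>1 / (\<tau>\<^sup>2 + 1)\<close> to \<open>1 / \<tau>\<^sup>2\<close> lies between \<open>\<tau>\<^sub>0\<^sup>2 / (\<tau>\<^sub>0\<^sup>2 + 1) = (1 + r) / 2\<close> and \<open>1\<close>.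
\<close>

lemma measure_bvn_tail_bounds:
  assumes r: "r \<in> {-1<..<1}" and ab: "0 < b" "b \<le> a"
  defines "\<tau>\<^sub>0 \<equiv> sqrt ((1 + r) / (1 - r))"
  shows "(1 + r) / 2 * tail_bound a b \<tau>\<^sub>0 \<le> measure (bvn r) ({a<..} \<times> {..b})"
    and "measure (bvn r) ({a<..} \<times> {..b}) \<le> tail_bound a b \<tau>\<^sub>0"
    and "0 \<le> tail_bound a b \<tau>\<^sub>0"
proof -
  have \<tau>\<^sub>0: "0 < \<tau>\<^sub>0" using r by (simp add: \<tau>\<^sub>0_def)
  have sq: "\<tau>\<^sub>0\<^sup>2 = (1 + r) / (1 - r)" using r by (simp add: \<tau>\<^sub>0_def)
  show nonneg: "0 \<le> tail_bound a b \<tau>\<^sub>0"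
    by (rule tail_bound_integral(2)[OF \<tau>\<^sub>0 ab])
  let ?e = "\<lambda>\<tau>. std_normal_density a * std_normal_density (((a + b) / \<tau> - (a - b) * \<tau>) / 2)"
  note E = emeasure_bvn_tail_eq[OF r ab, folded \<tau>\<^sub>0_def] and T = tail_bound_integral(1)[OF \<tau>\<^sub>0 ab]
  note fin = bvn_cdf_eq_margin_minus_tail(2)[OF r, of a b]
  have "emeasure (bvn r) ({a<..} \<times> {..b}) \<le> ennreal (tail_bound a b \<tau>\<^sub>0)"
    unfolding E T[symmetric] using \<tau>\<^sub>0
    by (intro nn_integral_mono)
       (auto intro!: ennreal_leI mult_right_mono divide_left_mono mult_pos_pos add_nonneg_pos split: split_indicator)
  then show "measure (bvn r) ({a<..} \<times> {..b}) \<le> tail_bound a b \<tau>\<^sub>0"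
    using nonneg fin by (simp add: emeasure_eq_ennreal_measure)
  have frac: "(1 + r) / 2 * (2 / \<tau>\<^sup>2) \<le> 2 / (\<tau>\<^sup>2 + 1)" if "\<tau>\<^sub>0 \<le> \<tau>" for \<tau>
  proof -
    have "\<tau>\<^sub>0\<^sup>2 \<le> \<tau>\<^sup>2" using that \<tau>\<^sub>0 by (intro power_mono) auto
    then have "1 + r \<le> \<tau>\<^sup>2 * (1 - r)" using r by (simp add: sq field_simps)
    moreover have "0 < \<tau>\<^sup>2" using that \<tau>\<^sub>0 by simp
    ultimately show ?thesis by (simp add: field_simps add_pos_pos)
  qed
  have c0: "0 \<le> (1 + r) / 2" using r by simp
  have "ennreal ((1 + r) / 2 * tail_bound a b \<tau>\<^sub>0)
      = (\<integral>\<^sup>+\<tau>. ennreal ((1 + r) / 2 * (2 / \<tau>\<^sup>2) * ?e \<tau>) * indicator {\<tau>\<^sub>0..} \<tau> \<partial>lborel)"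
    unfolding ennreal_mult'[OF c0] T[symmetric]
    by (subst nn_integral_cmult[symmetric]) (measurable, simp only: ennreal_mult'[OF c0] mult.assoc)
  also have "\<dots> \<le> emeasure (bvn r) ({a<..} \<times> {..b})"
    unfolding E
  proof (rule nn_integral_mono)
    fix \<tau>
    show "ennreal ((1 + r) / 2 * (2 / \<tau>\<^sup>2) * ?e \<tau>) * indicator {\<tau>\<^sub>0..} \<tau>
        \<le> ennreal (2 / (\<tau>\<^sup>2 + 1) * std_normal_density a * std_normal_density (((a + b) / \<tau> - (a - b) * \<tau>) / 2)) * indicator {\<tau>\<^sub>0..} \<tau>"
    proof (cases "\<tau>\<^sub>0 \<le> \<tau>")
      case True
      have "(1 + r) / 2 * (2 / \<tau>\<^sup>2) * ?e \<tau> \<le> 2 / (\<tau>\<^sup>2 + 1) * ?e \<tau>"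
        by (rule mult_right_mono[OF frac[OF True]]) simp
      then show ?thesis using True by (simp add: mult.assoc ennreal_leI)
    qed simp
  qed
  finally show "(1 + r) / 2 * tail_bound a b \<tau>\<^sub>0 \<le> measure (bvn r) ({a<..} \<times> {..b})"
    using fin by (simp add: emeasure_eq_ennreal_measure)
qed

section \<open>Asymptotics of extreme normal quantiles\<close>

lemma ln_ln_real_at_top: "filterlim (\<lambda>n. ln (ln (real n))) at_top sequentially"
  by real_asymp

lemma ln_real_at_top: "filterlim (\<lambda>n. ln (real n)) at_top sequentially"
  by real_asymp

lemma quantile_at_top:
  assumes q: "\<forall>\<^sub>F n in sequentially. Phi (a n) = 1 + x / real n"
  shows "filterlim a at_top sequentially"
  unfolding filterlim_at_top
proof
  fix K
  have "(\<lambda>n. 1 + x / real n) \<longlonglongrightarrow> 1" by real_asymp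
  then have "\<forall>\<^sub>F n in sequentially. Phi K < 1 + x / real n"
    by (rule order_tendstoD) simp
  with q show "\<forall>\<^sub>F n in sequentially. K \<le> a n"
    by eventually_elim (metis Phi_less_iff less_imp_le)
qed

text \<open>
  Mills' ratio turns the implicit equation for the quantile into an explicit one: \<open>R\<close> equals \<open>- x\<close> up to
  a relative error of order \<open>1 / a\<^sup>2\<close>.
\<close>

lemma quantile_Mills:
  assumes q: "\<forall>\<^sub>F n in sequentially. Phi (a n) = 1 + x / real n"
  defines "R \<equiv> \<lambda>n. real n * std_normal_density (a n) / a n"
  shows "\<forall>\<^sub>F n in sequentially. 0 \<le> R n + x \<and> R n + x \<le> R n / (a n)\<^sup>2"
proof -
  have "\<forall>\<^sub>F n in sequentially. 0 < a n"
    using quantile_at_top[OF q] by (rule eventually_compose_filterlim[OF eventually_gt_at_top])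
  with q eventually_gt_at_top[of 0] show ?thesis
  proof eventually_elim
    case (elim n)
    have "1 - Phi (a n) = - x / real n" using elim by simp
    then have u: "- x / real n \<le> std_normal_density (a n) / a n"
      and l: "std_normal_density (a n) / a n * (1 - 1 / (a n)\<^sup>2) \<le> - x / real n"
      using Mills_upper[OF elim(3)] Mills_lower[OF elim(3)] by auto
    have "- x \<le> R n"
      using mult_left_mono[OF u, of "real n"] elim by (simp add: R_def)
    moreover have "R n * (1 - 1 / (a n)\<^sup>2) \<le> - x"
      using mult_left_mono[OF l, of "real n"] elim by (simp add: R_def mult.assoc)
    ultimately show ?case by (simp add: right_diff_distrib)
  qed
qed

text \<open>
  Taking logarithms of \<open>R\<close> gives \<open>ln n = a\<^sup>2 / 2 + ln a + O(1)\<close>, and inverting this relation gives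
  \<open>a\<^sup>2 = 2 ln n - ln ln n + O(1)\<close>. The term \<open>ln a\<close> is the origin of the iterated logarithm in the
  rate of convergence.
\<close>

lemma quantile_asymptotics:
  assumes x: "x < 0" and q: "\<forall>\<^sub>F n in sequentially. Phi (a n) = 1 + x / real n"
  defines "R \<equiv> \<lambda>n. real n * std_normal_density (a n) / a n"
  shows "R \<longlonglongrightarrow> - x"
    and "\<forall>\<^sub>F n in sequentially. ln (R n) = ln (real n) - (a n)\<^sup>2 / 2 - ln (a n) - ln (sqrt (2 * pi))"
    and "(\<lambda>n. (a n)\<^sup>2 / ln (real n)) \<longlonglongrightarrow> 2"
    and "(\<lambda>n. ((a n)\<^sup>2 - 2 * ln (real n)) / ln (ln (real n))) \<longlonglongrightarrow> - 1"
proof -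
  note top = quantile_at_top[OF q]
  have pos: "\<forall>\<^sub>F n in sequentially. 2 < a n" "\<forall>\<^sub>F n in sequentially. 2 < real n"
    using top by (auto intro: eventually_compose_filterlim[OF eventually_gt_at_top] simp: filterlim_real_sequentially)
  have inv0: "(\<lambda>n. 1 / (a n)\<^sup>2) \<longlonglongrightarrow> 0"
  proof -
    have "((\<lambda>z::real. 1 / z\<^sup>2) \<longlongrightarrow> 0) at_top" by real_asymp
    from filterlim_compose[OF this top] show ?thesis .
  qed
  have "\<forall>\<^sub>F n in sequentially. R n \<le> - x / (1 - 1 / (a n)\<^sup>2)"
    using quantile_Mills[OF q] pos(1)
  proof eventually_elim
    case (elim n)
    have "4 < (a n)\<^sup>2" using elim(2) power_strict_mono[of 2 "a n" 2] by simp
    then have "1 / (a n)\<^sup>2 < 1" using elim(2) by (simp add: divide_less_eq)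
    moreover have "R n * (1 - 1 / (a n)\<^sup>2) \<le> - x"
      using elim(1) by (simp add: R_def right_diff_distrib)
    ultimately show ?case by (subst pos_le_divide_eq) auto
  qed
  moreover have "\<forall>\<^sub>F n in sequentially. - x \<le> R n"
    using quantile_Mills[OF q] by eventually_elim (simp add: R_def)
  moreover have "(\<lambda>n. - x / (1 - 1 / (a n)\<^sup>2)) \<longlonglongrightarrow> - x / (1 - 0)"
    by (intro tendsto_intros inv0) auto
  ultimately show R: "R \<longlonglongrightarrow> - x"
    by (intro tendsto_sandwich[of "\<lambda>_. - x" R sequentially "\<lambda>n. - x / (1 - 1 / (a n)\<^sup>2)"]) auto
  show lnR: "\<forall>\<^sub>F n in sequentially. ln (R n) = ln (real n) - (a n)\<^sup>2 / 2 - ln (a n) - ln (sqrt (2 * pi))"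
    using pos
    by eventually_elim (simp add: R_def std_normal_density_def ln_mult ln_div)
  have lnR_lim: "(\<lambda>n. ln (R n)) \<longlonglongrightarrow> ln (- x)"
    using R x by (intro tendsto_ln) auto
  define c where "c = (\<lambda>n. ln (R n) + ln (sqrt (2 * pi)))"
  have c: "c \<longlonglongrightarrow> ln (- x) + ln (sqrt (2 * pi))"
    unfolding c_def by (intro tendsto_intros lnR_lim)
  have L: "\<forall>\<^sub>F n in sequentially. ln (real n) = (a n)\<^sup>2 / 2 + ln (a n) + c n"
    using lnR by eventually_elim (simp add: c_def)
  have sq_ratio: "(\<lambda>n. ln (real n) / (a n)\<^sup>2) \<longlonglongrightarrow> 1 / 2"
  proof -
    have "((\<lambda>z::real. ln z / z\<^sup>2) \<longlongrightarrow> 0) at_top" by real_asymp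
    from filterlim_compose[OF this top]
    have "(\<lambda>n. 1 / 2 + ln (a n) / (a n)\<^sup>2 + c n * (1 / (a n)\<^sup>2)) \<longlonglongrightarrow> 1 / 2 + 0 + (ln (- x) + ln (sqrt (2 * pi))) * 0"
      by (intro tendsto_intros c inv0)
    then have "(\<lambda>n. 1 / 2 + ln (a n) / (a n)\<^sup>2 + c n * (1 / (a n)\<^sup>2)) \<longlonglongrightarrow> 1 / 2" by simp
    moreover have "\<forall>\<^sub>F n in sequentially. 1 / 2 + ln (a n) / (a n)\<^sup>2 + c n * (1 / (a n)\<^sup>2) = ln (real n) / (a n)\<^sup>2"
      using L pos(1) by eventually_elim (simp add: add_divide_distrib)
    ultimately show ?thesis by (rule Lim_transform_eventually)
  qed
  from tendsto_inverse[OF sq_ratio] show "(\<lambda>n. (a n)\<^sup>2 / ln (real n)) \<longlonglongrightarrow> 2"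
    by (simp add: field_simps)
  have ln_a_top: "filterlim (\<lambda>n. ln (a n)) at_top sequentially"
    by (rule filterlim_compose[OF ln_at_top top])
  have ratio: "(\<lambda>n. ln (ln (real n)) / ln (a n)) \<longlonglongrightarrow> 2"
  proof -
    have "(\<lambda>n. 2 + ln (ln (real n) / (a n)\<^sup>2) / ln (a n)) \<longlonglongrightarrow> 2 + 0"
      by (intro tendsto_add tendsto_const tendsto_divide_0[OF tendsto_ln[OF sq_ratio]]
          filterlim_at_top_imp_at_infinity ln_a_top) auto
    moreover have "\<forall>\<^sub>F n in sequentially. 2 + ln (ln (real n) / (a n)\<^sup>2) / ln (a n) = ln (ln (real n)) / ln (a n)"
      using pos
    proof eventually_elim
      case (elim n)
      have "ln (a n) > 0" "ln (real n) > 0" using elim by auto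
      then show ?case using elim by (simp add: ln_div ln_realpow diff_divide_distrib)
    qed
    ultimately show ?thesis by (auto intro: Lim_transform_eventually)
  qed
  have "(\<lambda>n. - 2 * inverse (ln (ln (real n)) / ln (a n)) - 2 * (c n / ln (ln (real n)))) \<longlonglongrightarrow> - 2 * inverse 2 - 2 * 0"
    by (intro tendsto_intros ratio tendsto_divide_0[OF c] filterlim_at_top_imp_at_infinity ln_ln_real_at_top) auto
  moreover have "\<forall>\<^sub>F n in sequentially. - 2 * inverse (ln (ln (real n)) / ln (a n)) - 2 * (c n / ln (ln (real n)))
      = ((a n)\<^sup>2 - 2 * ln (real n)) / ln (ln (real n))"
    using L by eventually_elim (simp add: diff_divide_distrib add_divide_distrib)
  ultimately show "(\<lambda>n. ((a n)\<^sup>2 - 2 * ln (real n)) / ln (ln (real n))) \<longlonglongrightarrow> - 1"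
    by (auto intro: Lim_transform_eventually)
qed

text \<open>
  The normalization of the theorem. A quantity is negligible for the second-order expansion if it tends
  to zero after multiplication by \<open>rate\<close>; in particular everything of order \<open>1 / ln n\<close> is.
\<close>

definition rate :: "nat \<Rightarrow> real" where
  "rate n = ln (real n) / ln (ln (real n))"

lemma rate_pos: "\<forall>\<^sub>F n in sequentially. 0 < rate n"
  unfolding rate_def by real_asymp

lemma rate_at_top: "filterlim rate at_top sequentially"
  unfolding rate_def[abs_def] by real_asymp

context
  fixes x :: real and a :: "nat \<Rightarrow> real"
  assumes x: "x < 0"
    and qa: "\<forall>\<^sub>F n in sequentially. Phi (a n) = 1 + x / real n"
begin

lemma rate_over_square: "(\<lambda>n. rate n / (a n)\<^sup>2) \<longlonglongrightarrow> 0"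
proof -
  have "(\<lambda>n. inverse ((a n)\<^sup>2 / ln (real n)) / ln (ln (real n))) \<longlonglongrightarrow> 0"
    by (intro tendsto_divide_0[OF tendsto_inverse[OF quantile_asymptotics(3)[OF x qa]]]
        filterlim_at_top_imp_at_infinity ln_ln_real_at_top) auto
  then show ?thesis by (simp add: rate_def field_simps)
qed

lemma rate_Mills: "(\<lambda>n. rate n * (real n * std_normal_density (a n) / a n + x)) \<longlonglongrightarrow> 0"
proof (rule tendsto_sandwich[OF _ _ tendsto_const])
  let ?R = "\<lambda>n. real n * std_normal_density (a n) / a n"
  show "\<forall>\<^sub>F n in sequentially. 0 \<le> rate n * (?R n + x)"
    using rate_pos quantile_Mills[OF qa] by eventually_elim simp
  show "\<forall>\<^sub>F n in sequentially. rate n * (?R n + x) \<le> ?R n * (rate n / (a n)\<^sup>2)"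
    using rate_pos quantile_Mills[OF qa]
  proof eventually_elim
    case (elim n)
    then have "rate n * (?R n + x) \<le> rate n * (?R n / (a n)\<^sup>2)"
      by (intro mult_left_mono) auto
    then show ?case by (simp add: mult_ac)
  qed
  show "(\<lambda>n. ?R n * (rate n / (a n)\<^sup>2)) \<longlonglongrightarrow> 0"
    using tendsto_mult[OF quantile_asymptotics(1)[OF x qa] rate_over_square] by simp
qed

lemma rate_ln_Mills: "(\<lambda>n. rate n * (ln (real n * std_normal_density (a n) / a n) - ln (- x))) \<longlonglongrightarrow> 0"
proof (rule tendsto_sandwich[OF _ _ tendsto_const])
  let ?R = "\<lambda>n. real n * std_normal_density (a n) / a n"
  show "\<forall>\<^sub>F n in sequentially. 0 \<le> rate n * (ln (?R n) - ln (- x))"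
    using rate_pos quantile_Mills[OF qa]
  proof eventually_elim
    case (elim n)
    then have "ln (- x) \<le> ln (?R n)" using x by (intro ln_mono) auto
    then show ?case using elim by simp
  qed
  show "\<forall>\<^sub>F n in sequentially. rate n * (ln (?R n) - ln (- x)) \<le> rate n * (?R n + x) / (- x)"
    using rate_pos quantile_Mills[OF qa]
  proof eventually_elim
    case (elim n)
    then have R: "- x \<le> ?R n" by simp
    then have pos: "0 < ?R n" using x by linarith
    have "ln (?R n) - ln (- x) = ln (?R n / (- x))"
      by (rule ln_divide_pos[OF pos, symmetric]) (use x in simp)
    also have "\<dots> \<le> ?R n / (- x) - 1"
      by (rule ln_le_minus_one, rule divide_pos_pos[OF pos]) (use x in simp)
    also have "\<dots> = (?R n + x) / (- x)"
      using x by (simp add: add_divide_distrib)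
    finally have "rate n * (ln (?R n) - ln (- x)) \<le> rate n * ((?R n + x) / (- x))"
      using elim by (intro mult_left_mono) auto
    then show ?case by simp
  qed
  show "(\<lambda>n. rate n * (?R n + x) / (- x)) \<longlonglongrightarrow> 0"
    using tendsto_divide[OF rate_Mills tendsto_const[of "- x"]] x by simp
qed

end

context
  fixes x y :: real and a b :: "nat \<Rightarrow> real"
  assumes x: "x < 0" and y: "y < 0"
    and qa: "\<forall>\<^sub>F n in sequentially. Phi (a n) = 1 + x / real n"
    and qb: "\<forall>\<^sub>F n in sequentially. Phi (b n) = 1 + y / real n"
begin

lemma quantiles_pos: "\<forall>\<^sub>F n in sequentially. 0 < a n \<and> 0 < b n"
  using quantile_at_top[OF qa] quantile_at_top[OF qb]
  by (intro eventually_conj) (auto intro: eventually_compose_filterlim[OF eventually_gt_at_top])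

lemma quantile_square_diff: "(\<lambda>n. ((b n)\<^sup>2 - (a n)\<^sup>2) / 2) \<longlonglongrightarrow> ln (- x) - ln (- y)"
proof -
  let ?R = "\<lambda>a n. real n * std_normal_density (a n) / a n"
  have ratio: "(\<lambda>n. ((a n)\<^sup>2 / ln (real n)) / ((b n)\<^sup>2 / ln (real n))) \<longlonglongrightarrow> 2 / 2"
    by (intro tendsto_divide quantile_asymptotics(3)[OF x qa] quantile_asymptotics(3)[OF y qb]) auto
  have "(\<lambda>n. ln (((a n)\<^sup>2 / ln (real n)) / ((b n)\<^sup>2 / ln (real n))) / 2) \<longlonglongrightarrow> ln (2 / 2) / 2"
    by (intro tendsto_divide tendsto_ln[OF ratio] tendsto_const) auto
  moreover have "(\<lambda>n. ln (?R a n) - ln (?R b n)) \<longlonglongrightarrow> ln (- x) - ln (- y)"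
    using x y
    by (intro tendsto_intros quantile_asymptotics(1)[OF x qa] quantile_asymptotics(1)[OF y qb]) auto
  ultimately have "(\<lambda>n. ln (((a n)\<^sup>2 / ln (real n)) / ((b n)\<^sup>2 / ln (real n))) / 2 + (ln (?R a n) - ln (?R b n)))
      \<longlonglongrightarrow> ln (2 / 2) / 2 + (ln (- x) - ln (- y))"
    by (rule tendsto_add)
  moreover have "\<forall>\<^sub>F n in sequentially. ln (((a n)\<^sup>2 / ln (real n)) / ((b n)\<^sup>2 / ln (real n))) / 2 + (ln (?R a n) - ln (?R b n))
      = ((b n)\<^sup>2 - (a n)\<^sup>2) / 2"
    using quantiles_pos eventually_gt_at_top[of 1]
      quantile_asymptotics(2)[OF x qa] quantile_asymptotics(2)[OF y qb]
  proof eventually_elim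
    case (elim n)
    then have "ln (((a n)\<^sup>2 / ln (real n)) / ((b n)\<^sup>2 / ln (real n))) = 2 * ln (a n) - 2 * ln (b n)"
      by (simp add: ln_div ln_realpow)
    then show ?case using elim(3,4) by (simp add: diff_divide_distrib)
  qed
  ultimately show ?thesis by (auto intro: Lim_transform_eventually)
qed

lemma quantile_ratio: "(\<lambda>n. b n / a n) \<longlonglongrightarrow> 1"
proof -
  have "(\<lambda>n. sqrt (((b n)\<^sup>2 / ln (real n)) / ((a n)\<^sup>2 / ln (real n)))) \<longlonglongrightarrow> sqrt (2 / 2)"
    by (intro tendsto_intros quantile_asymptotics(3)[OF x qa] quantile_asymptotics(3)[OF y qb]) auto
  moreover have "\<forall>\<^sub>F n in sequentially. sqrt (((b n)\<^sup>2 / ln (real n)) / ((a n)\<^sup>2 / ln (real n))) = b n / a n"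
    using quantiles_pos eventually_gt_at_top[of 1]
    by eventually_elim (simp add: real_sqrt_divide)
  ultimately show ?thesis by (auto intro: Lim_transform_eventually)
qed

text \<open>
  The next three lemmas treat the parameters of the closed form \<open>tail_bound\<close>. The weights and the log-ratio
  of the two levels reach their limits with negligible error; the scale \<open>(a + b)\<^sup>2 / (8 ln n)\<close>
  does not, and contributes the factor \<open>- 1 / 2\<close>.
\<close>

lemma rate_weight: "(\<lambda>n. rate n * (real n * std_normal_density (a n) * (2 / (a n + b n)) + x)) \<longlonglongrightarrow> 0"
proof -
  let ?R = "\<lambda>n. real n * std_normal_density (a n) / a n"
  let ?D = "\<lambda>n. ((b n)\<^sup>2 - (a n)\<^sup>2) / 2"
  have "(\<lambda>n. rate n * (?R n + x)
      - ?R n * (rate n / (a n)\<^sup>2) * ?D n * (2 / (1 + b n / a n)\<^sup>2)) \<longlonglongrightarrow>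
      0 - (- x) * 0 * (ln (- x) - ln (- y)) * (2 / (1 + 1)\<^sup>2)"
    by (intro tendsto_intros rate_Mills[OF x qa] quantile_square_diff quantile_ratio
        rate_over_square[OF x qa] quantile_asymptotics(1)[OF x qa]) auto
  moreover have "\<forall>\<^sub>F n in sequentially. rate n * (?R n + x)
      - ?R n * (rate n / (a n)\<^sup>2) * ?D n * (2 / (1 + b n / a n)\<^sup>2)
      = rate n * (real n * std_normal_density (a n) * (2 / (a n + b n)) + x)"
    using quantiles_pos
  proof eventually_elim
    case (elim n)
    have "1 + b n / a n = (a n + b n) / a n" using elim by (simp add: field_simps)
    then have "?D n / (a n)\<^sup>2 * (2 / (1 + b n / a n)\<^sup>2) = ?D n / (a n)\<^sup>2 * (2 / ((a n + b n)\<^sup>2 / (a n)\<^sup>2))"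
      by (simp only: power_divide)
    also have "\<dots> = ((b n)\<^sup>2 - (a n)\<^sup>2) / (a n + b n)\<^sup>2"
    proof -
      have "d / 2 / s * (2 / (t / s)) = d / t" if "0 < s" for d s t :: real
        using that by (cases "t = 0") (auto simp: field_simps)
      then show ?thesis using elim by simp
    qed
    also have "\<dots> = (b n - a n) * (b n + a n) / (a n + b n)\<^sup>2"
      by (simp add: power2_eq_square algebra_simps)
    also have "\<dots> = (b n - a n) / (a n + b n)"
      by (simp add: power2_eq_square add.commute)
    also have "\<dots> = 1 - 2 * a n / (a n + b n)"
      using elim by (simp add: field_simps)
    finally have "1 - ?D n / (a n)\<^sup>2 * (2 / (1 + b n / a n)\<^sup>2) = 2 * a n / (a n + b n)" by simp
    moreover have collect: "k * (s + x) - s * (k / q) * d * t = k * (s * (1 - d / q * t) + x)" for k s q d t :: real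
      by (simp add: algebra_simps)
    have "rate n * (?R n + x) - ?R n * (rate n / (a n)\<^sup>2) * ?D n * (2 / (1 + b n / a n)\<^sup>2)
        = rate n * (?R n * (1 - ?D n / (a n)\<^sup>2 * (2 / (1 + b n / a n)\<^sup>2)) + x)"
      by (rule collect)
    ultimately show ?case using elim by simp
  qed
  ultimately show ?thesis by (auto intro: Lim_transform_eventually)
qed

lemma rate_quantile_square_diff:
  "(\<lambda>n. rate n * (((b n)\<^sup>2 - (a n)\<^sup>2) / 2 - ln (x / y))) \<longlonglongrightarrow> 0"
proof -
  let ?R = "\<lambda>a n. real n * std_normal_density (a n) / a n"
  let ?D = "\<lambda>n. ((b n)\<^sup>2 - (a n)\<^sup>2) / 2"
  have "(\<lambda>n. rate n * (ln (b n) - ln (a n))) \<longlonglongrightarrow> 0"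
  proof (rule tendsto_sandwich)
    \<comment> \<open>The elementary bound \<open>ln t \<le> t - 1\<close> used in both directions reduces the difference of logarithms to that of squares.\<close>
    have lnle: "ln v - ln u \<le> (v\<^sup>2 - u\<^sup>2) / 2 / u\<^sup>2" if "0 < u" "0 < v" for u v :: real
    proof -
      have "ln (v\<^sup>2 / u\<^sup>2) \<le> v\<^sup>2 / u\<^sup>2 - 1" using that by (intro ln_le_minus_one) simp
      moreover have "ln (v\<^sup>2 / u\<^sup>2) = 2 * (ln v - ln u)" using that by (simp add: ln_div ln_realpow)
      ultimately show ?thesis using that by (simp add: diff_divide_distrib)
    qed
    show "\<forall>\<^sub>F n in sequentially. rate n * (ln (b n) - ln (a n)) \<le> rate n / (a n)\<^sup>2 * ?D n"
      using rate_pos quantiles_pos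
    proof eventually_elim
      case (elim n)
      then show ?case using mult_left_mono[OF lnle[of "a n" "b n"], of "rate n"] by (simp add: mult_ac)
    qed
    show "\<forall>\<^sub>F n in sequentially. rate n / (b n)\<^sup>2 * ?D n \<le> rate n * (ln (b n) - ln (a n))"
      using rate_pos quantiles_pos
    proof eventually_elim
      case (elim n)
      have "?D n / (b n)\<^sup>2 \<le> ln (b n) - ln (a n)"
        using lnle[of "b n" "a n"] elim by (simp add: field_simps)
      from mult_left_mono[OF this, of "rate n"] show ?case using elim by (simp add: mult_ac)
    qed
    show "(\<lambda>n. rate n / (a n)\<^sup>2 * ?D n) \<longlonglongrightarrow> 0"
      using tendsto_mult[OF rate_over_square[OF x qa] quantile_square_diff] by simp
    show "(\<lambda>n. rate n / (b n)\<^sup>2 * ?D n) \<longlonglongrightarrow> 0"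
      using tendsto_mult[OF rate_over_square[OF y qb] quantile_square_diff] by simp
  qed
  from tendsto_diff[OF tendsto_diff[OF rate_ln_Mills[OF x qa] rate_ln_Mills[OF y qb]] this]
  have "(\<lambda>n. rate n * (ln (?R a n) - ln (- x)) - rate n * (ln (?R b n) - ln (- y))
      - rate n * (ln (b n) - ln (a n))) \<longlonglongrightarrow> 0" by simp
  moreover have "\<forall>\<^sub>F n in sequentially. rate n * (ln (?R a n) - ln (- x)) - rate n * (ln (?R b n) - ln (- y))
      - rate n * (ln (b n) - ln (a n)) = rate n * (?D n - ln (x / y))"
    using quantile_asymptotics(2)[OF x qa] quantile_asymptotics(2)[OF y qb]
  proof eventually_elim
    case (elim n)
    have lnxy: "ln (x / y) = ln (- x) - ln (- y)"
      using ln_div[of "- x" "- y"] x y by simp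
    show ?case unfolding elim lnxy right_diff_distrib[symmetric]
      by (rule arg_cong[where f = "\<lambda>t. rate n * t"]) (simp add: diff_divide_distrib)
  qed
  ultimately show ?thesis by (auto intro: Lim_transform_eventually)
qed

lemma rate_quantile_sum_square:
  "(\<lambda>n. rate n * ((a n + b n)\<^sup>2 / (8 * ln (real n)) - 1)) \<longlonglongrightarrow> - 1 / 2"
proof -
  let ?D = "\<lambda>n. ((b n)\<^sup>2 - (a n)\<^sup>2) / 2"
  have "((\<lambda>z::real. 1 / z\<^sup>2) \<longlongrightarrow> 0) at_top" by real_asymp
  from filterlim_compose[OF this quantile_at_top[OF qa]]
  have inv0: "(\<lambda>n. 1 / (a n)\<^sup>2) \<longlonglongrightarrow> 0" .
  have "(\<lambda>n. (((a n)\<^sup>2 - 2 * ln (real n)) / ln (ln (real n)) + ((b n)\<^sup>2 - 2 * ln (real n)) / ln (ln (real n))) / 4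
      - ((2 * ?D n)\<^sup>2 * (1 / (a n)\<^sup>2) / (1 + b n / a n)\<^sup>2) / 8 / ln (ln (real n)))
      \<longlonglongrightarrow> (- 1 + - 1) / 4 - 0"
    by (intro tendsto_diff tendsto_divide tendsto_add tendsto_const quantile_asymptotics(4)[OF x qa] quantile_asymptotics(4)[OF y qb]
        tendsto_divide_0[OF tendsto_divide[OF tendsto_divide[OF tendsto_mult[OF
           tendsto_power[OF tendsto_mult[OF tendsto_const quantile_square_diff]] inv0]
             tendsto_power[OF tendsto_add[OF tendsto_const quantile_ratio]]] tendsto_const]]
        filterlim_at_top_imp_at_infinity ln_ln_real_at_top) auto
  moreover have "\<forall>\<^sub>F n in sequentially.
      (((a n)\<^sup>2 - 2 * ln (real n)) / ln (ln (real n)) + ((b n)\<^sup>2 - 2 * ln (real n)) / ln (ln (real n))) / 4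
      - ((2 * ?D n)\<^sup>2 * (1 / (a n)\<^sup>2) / (1 + b n / a n)\<^sup>2) / 8 / ln (ln (real n))
     = rate n * ((a n + b n)\<^sup>2 / (8 * ln (real n)) - 1)"
    using quantiles_pos eventually_gt_at_top[of 1] rate_pos
  proof eventually_elim
    case (elim n)
    have L: "ln (real n) \<noteq> 0" using elim by simp
    have "2 * ?D n = (b n)\<^sup>2 - (a n)\<^sup>2" by simp
    also have "\<dots> = (b n - a n) * (a n + b n)" by (simp add: power2_eq_square algebra_simps)
    finally have D2: "2 * ?D n = (b n - a n) * (a n + b n)" .
    have "1 + b n / a n = (a n + b n) / a n" using elim by (simp add: field_simps)
    then have "(2 * ?D n)\<^sup>2 * (1 / (a n)\<^sup>2) / (1 + b n / a n)\<^sup>2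
        = (2 * ?D n)\<^sup>2 * (1 / (a n)\<^sup>2) / ((a n + b n)\<^sup>2 / (a n)\<^sup>2)"
      by (simp only: power_divide)
    also have "\<dots> = (2 * ?D n)\<^sup>2 / (a n + b n)\<^sup>2"
      using elim by simp
    also have "(2 * ?D n)\<^sup>2 / (a n + b n)\<^sup>2 = ((b n - a n) * (a n + b n))\<^sup>2 / (a n + b n)\<^sup>2"
      by (simp only: D2)
    also have "((b n - a n) * (a n + b n))\<^sup>2 / (a n + b n)\<^sup>2 = (b n - a n)\<^sup>2"
      using elim by (simp add: power_mult_distrib)
    finally have e: "(2 * ?D n)\<^sup>2 * (1 / (a n)\<^sup>2) / (1 + b n / a n)\<^sup>2 = (b n - a n)\<^sup>2" .
    have "rate n * ((a n + b n)\<^sup>2 / (8 * ln (real n)) - 1) = ((a n + b n)\<^sup>2 - 8 * ln (real n)) / 8 / ln (ln (real n))"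
    proof -
      have "l / k * (s / (8 * l) - 1) = (s - 8 * l) / 8 / k" if "l \<noteq> 0" for k l s :: real
        using that by (cases "k = 0") (auto simp: field_simps)
      then show ?thesis using L by (simp add: rate_def)
    qed
    also have "(a n + b n)\<^sup>2 - 8 * ln (real n) = 2 * (((a n)\<^sup>2 - 2 * ln (real n)) + ((b n)\<^sup>2 - 2 * ln (real n))) - (b n - a n)\<^sup>2"
      by (simp add: power2_eq_square algebra_simps)
    finally show ?case unfolding e
      by (simp add: diff_divide_distrib add_divide_distrib)
  qed
  ultimately show ?thesis by (auto intro: Lim_transform_eventually)
qed

end

section \<open>Second-order expansion of one factor\<close>

text \<open>
  Minus the exponent measure of the Huesler--Reiss distribution: its exponential is the limit law for
  constant \<open>\<mu>\<close>.
\<close>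

definition HR_exponent :: "real \<Rightarrow> real \<Rightarrow> real \<Rightarrow> real" where
  "HR_exponent x y \<mu> = x * Phi (sqrt \<mu> + ln (x / y) / (2 * sqrt \<mu>)) + y * Phi (sqrt \<mu> + ln (y / x) / (2 * sqrt \<mu>))"

text \<open>
  This is \<open>- \<mu> / 2\<close> times the derivative of \<open>HR_exponent\<close> in \<open>\<mu>\<close>, as
  \<open>HR_exponent_has_derivative\<close> shows.
\<close>

definition HR_correction :: "real \<Rightarrow> real \<Rightarrow> real \<Rightarrow> real" where
  "HR_correction x y \<mu> = 1 / (2 * sqrt (2 * pi)) *
     (sqrt \<mu> * exp (- ((\<mu> - ln (x * y) + (ln (x / y))\<^sup>2 / (4 * \<mu>)) / 2)))"

text \<open>
  The common shape of the tail bound (\<open>tail_bound_eq_tail_profile\<close>) and of the limit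
  (\<open>HR_exponent_eq_tail_profile\<close>).
\<close>

definition tail_profile :: "real \<Rightarrow> real \<Rightarrow> real \<Rightarrow> real \<Rightarrow> real" where
  "tail_profile \<alpha> \<beta> w l = \<alpha> * Phi (sqrt l + w / (2 * sqrt l)) - \<beta> * Phi (- sqrt l + w / (2 * sqrt l))"

lemma ln_div_neg: "x < 0 \<Longrightarrow> y < 0 \<Longrightarrow> ln (x / y) = ln (- x) - ln (- y)" for x y :: real
  using ln_divide_pos[of "- x" "- y"] by simp

lemma HR_exponent_commute: "HR_exponent x y \<mu> = HR_exponent y x \<mu>"
  by (simp add: HR_exponent_def)

lemma HR_correction_commute: "x < 0 \<Longrightarrow> y < 0 \<Longrightarrow> HR_correction x y \<mu> = HR_correction y x \<mu>"
  by (simp add: HR_correction_def ln_div_neg mult.commute power2_commute)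

lemma HR_correction_pos: "0 < \<mu> \<Longrightarrow> 0 < HR_correction x y \<mu>"
  by (simp add: HR_correction_def)

lemma HR_exponent_eq_tail_profile:
  assumes "x < 0" "y < 0"
  shows "HR_exponent x y \<mu> = y - tail_profile (- x) (- y) (ln (x / y)) \<mu>"
proof -
  have "sqrt \<mu> + ln (y / x) / (2 * sqrt \<mu>) = - (- sqrt \<mu> + ln (x / y) / (2 * sqrt \<mu>))"
    using assms by (simp add: ln_div_neg diff_divide_distrib)
  then show ?thesis
    unfolding HR_exponent_def tail_profile_def by (simp only: Phi_minus) (simp add: algebra_simps)
qed

text \<open>
  Completing the square in the exponent shows that the two densities occurring in the derivative of the
  profile agree after weighting with \<open>- x\<close> and \<open>- y\<close>.
\<close>

lemma HR_correction_eq: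
  assumes "x < 0" "y < 0" "0 < l"
  defines "w \<equiv> ln (x / y)"
  shows "HR_correction x y l = sqrt l / 2 * (- x * std_normal_density (sqrt l + w / (2 * sqrt l)))"
    and "HR_correction x y l = sqrt l / 2 * (- y * std_normal_density (- sqrt l + w / (2 * sqrt l)))"
proof -
  have w: "w = ln (- x) - ln (- y)" unfolding w_def by (rule ln_div_neg) fact+
  have xy: "ln (x * y) = ln (- x) + ln (- y)"
    using ln_mult_pos[of "- x" "- y"] assms by simp
  have expx: "- x = exp (ln (- x))" "- y = exp (ln (- y))" using assms by auto
  define s where "s = sqrt l"
  have s: "0 < s" "l = s\<^sup>2" using assms by (auto simp: s_def)
  have sq1: "(s + w / (2 * s))\<^sup>2 = l + w + w\<^sup>2 / (4 * l)" and sq2: "(- s + w / (2 * s))\<^sup>2 = l - w + w\<^sup>2 / (4 * l)"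
    using s(1) unfolding s(2) by (auto simp: field_simps power2_eq_square)
  have e1: "- x * exp (- (s + w / (2 * s))\<^sup>2 / 2) = exp (- ((l - ln (x * y) + w\<^sup>2 / (4 * l)) / 2))"
    unfolding sq1 by (subst expx(1)) (simp only: exp_add[symmetric] xy w, rule arg_cong[where f = exp], simp add: field_simps)
  have e2: "- y * exp (- (- s + w / (2 * s))\<^sup>2 / 2) = exp (- ((l - ln (x * y) + w\<^sup>2 / (4 * l)) / 2))"
    unfolding sq2 by (subst expx(2)) (simp only: exp_add[symmetric] xy w, rule arg_cong[where f = exp], simp add: field_simps)
  show "HR_correction x y l = sqrt l / 2 * (- x * std_normal_density (sqrt l + w / (2 * sqrt l)))"
    unfolding HR_correction_def w_def[symmetric] s_def[symmetric] std_normal_density_def e1[symmetric] by simp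
  show "HR_correction x y l = sqrt l / 2 * (- y * std_normal_density (- sqrt l + w / (2 * sqrt l)))"
    unfolding HR_correction_def w_def[symmetric] s_def[symmetric] std_normal_density_def e2[symmetric] by simp
qed

lemma tail_profile_has_derivative:
  assumes "x < 0" "y < 0" "0 < l"
  shows "(tail_profile (- x) (- y) (ln (x / y)) has_real_derivative 2 * HR_correction x y l / l) (at l)"
proof -
  define w where "w = ln (x / y)"
  define s where "s = sqrt l"
  have s: "0 < s" "l = s\<^sup>2" using assms by (auto simp: s_def)
  have d1: "((\<lambda>l. sqrt l + w / (2 * sqrt l)) has_real_derivative (1 / (2 * s) - w / (4 * s ^ 3))) (at l)"
    and d2: "((\<lambda>l. - sqrt l + w / (2 * sqrt l)) has_real_derivative (- 1 / (2 * s) - w / (4 * s ^ 3))) (at l)"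
    using assms s by (auto intro!: derivative_eq_intros simp: s_def[symmetric] field_simps power3_eq_cube power2_eq_square)
  have "(tail_profile (- x) (- y) w has_real_derivative
      - x * (std_normal_density (s + w / (2 * s)) * (1 / (2 * s) - w / (4 * s ^ 3)))
      - - y * (std_normal_density (- s + w / (2 * s)) * (- 1 / (2 * s) - w / (4 * s ^ 3)))) (at l)"
    unfolding tail_profile_def[abs_def] s_def
    by (intro DERIV_diff DERIV_cmult Phi_has_derivative_chain d1[unfolded s_def] d2[unfolded s_def])
  also have "- x * (std_normal_density (s + w / (2 * s)) * (1 / (2 * s) - w / (4 * s ^ 3)))
      - - y * (std_normal_density (- s + w / (2 * s)) * (- 1 / (2 * s) - w / (4 * s ^ 3)))
     = (- x * std_normal_density (s + w / (2 * s))) * (1 / (2 * s) - w / (4 * s ^ 3))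
      - (- y * std_normal_density (- s + w / (2 * s))) * (- 1 / (2 * s) - w / (4 * s ^ 3))"
    by (simp only: mult.assoc)
  also have "- x * std_normal_density (s + w / (2 * s)) = 2 * HR_correction x y l / s"
    using HR_correction_eq(1)[OF assms] s(1) by (simp add: s_def[symmetric] w_def[symmetric])
  also have "- y * std_normal_density (- s + w / (2 * s)) = 2 * HR_correction x y l / s"
    using HR_correction_eq(2)[OF assms] s(1) by (simp add: s_def[symmetric] w_def[symmetric])
  also have "2 * HR_correction x y l / s * (1 / (2 * s) - w / (4 * s ^ 3)) - 2 * HR_correction x y l / s * (- 1 / (2 * s) - w / (4 * s ^ 3))
     = 2 * HR_correction x y l / l"
    unfolding right_diff_distrib[symmetric] using s(1) by (simp add: s(2) power2_eq_square)
  finally show ?thesis unfolding w_def .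
qed

lemma HR_exponent_has_derivative:
  assumes "x < 0" "y < 0" "0 < l"
  shows "(HR_exponent x y has_real_derivative - (2 * HR_correction x y l / l)) (at l)"
proof -
  have "((\<lambda>l. y - tail_profile (- x) (- y) (ln (x / y)) l) has_real_derivative 0 - (2 * HR_correction x y l / l)) (at l)"
    by (intro DERIV_diff DERIV_const tail_profile_has_derivative assms)
  then show ?thesis
    by (simp add: HR_exponent_eq_tail_profile[OF assms(1,2), abs_def])
qed

lemma Phi_lipschitz: "\<bar>Phi s - Phi t\<bar> \<le> \<bar>s - t\<bar>"
proof -
  have "norm (Phi s - Phi t) \<le> 1 * norm (s - t)"
    by (rule field_differentiable_bound[of UNIV Phi std_normal_density])
      (auto simp: std_normal_density_le_1 intro: Phi_has_derivative)
  then show ?thesis by simp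
qed

text \<open>
  The profile is Lipschitz in its weights and in \<open>w\<close> as long as \<open>l\<close> stays away from zero, so the
  negligible errors of these parameters stay negligible.
\<close>

lemma tail_profile_perturb:
  assumes "0 < l"
  shows "\<bar>tail_profile \<alpha> \<beta> w l - tail_profile \<alpha>' \<beta>' w' l\<bar>
    \<le> \<bar>\<alpha> - \<alpha>'\<bar> + \<bar>\<beta> - \<beta>'\<bar> + (\<bar>\<alpha>'\<bar> + \<bar>\<beta>'\<bar>) * (\<bar>w - w'\<bar> / (2 * sqrt l))"
proof -
  have s: "0 < sqrt l" using assms by simp
  have one: "\<bar>c * Phi (u + w / (2 * sqrt l)) - c' * Phi (u + w' / (2 * sqrt l))\<bar>
      \<le> \<bar>c - c'\<bar> + \<bar>c'\<bar> * (\<bar>w - w'\<bar> / (2 * sqrt l))" for c c' u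
  proof -
    let ?P = "Phi (u + w / (2 * sqrt l))" and ?Q = "Phi (u + w' / (2 * sqrt l))"
    have "\<bar>?P - ?Q\<bar> \<le> \<bar>w - w'\<bar> / (2 * sqrt l)"
      using Phi_lipschitz[of "u + w / (2 * sqrt l)" "u + w' / (2 * sqrt l)"] s
      by (simp add: diff_divide_distrib[symmetric] abs_divide)
    then have "\<bar>c'\<bar> * \<bar>?P - ?Q\<bar> \<le> \<bar>c'\<bar> * (\<bar>w - w'\<bar> / (2 * sqrt l))"
      by (intro mult_left_mono) auto
    moreover have "\<bar>c - c'\<bar> * ?P \<le> \<bar>c - c'\<bar>"
      using Phi_le_1 by (intro mult_right_le_one_le) auto
    moreover have "c * ?P - c' * ?Q = (c - c') * ?P + c' * (?P - ?Q)"
      by (simp add: algebra_simps)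
    ultimately show ?thesis
      using abs_triangle_ineq[of "(c - c') * ?P" "c' * (?P - ?Q)"] by (simp add: abs_mult)
  qed
  show ?thesis
    using one[of \<alpha> "sqrt l" \<alpha>'] one[of \<beta> "- sqrt l" \<beta>'] unfolding tail_profile_def
    by (simp only: distrib_right) linarith
qed

lemma tail_bound_eq_tail_profile:
  assumes "0 < b" "b \<le> a" "0 < \<tau>"
  shows "tail_bound a b \<tau> = tail_profile (std_normal_density a * (2 / (a + b))) (std_normal_density b * (2 / (a + b)))
            ((b\<^sup>2 - a\<^sup>2) / 2) ((a + b)\<^sup>2 / (4 * \<tau>\<^sup>2))"
proof -
  have ab: "0 < a + b" using assms by simp
  have "sqrt ((a + b)\<^sup>2 / (4 * \<tau>\<^sup>2)) = sqrt (((a + b) / (2 * \<tau>))\<^sup>2)"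
    by (simp add: power_divide power_mult_distrib)
  also have "\<dots> = (a + b) / (2 * \<tau>)"
    using ab assms by simp
  finally have root: "sqrt ((a + b)\<^sup>2 / (4 * \<tau>\<^sup>2)) = (a + b) / (2 * \<tau>)" .
  have "(b\<^sup>2 - a\<^sup>2) / 2 / (2 * ((a + b) / (2 * \<tau>))) = ((b - a) * (a + b)) / (a + b) * \<tau> / 2"
    using assms by (simp add: field_simps power2_eq_square)
  then have shift: "(b\<^sup>2 - a\<^sup>2) / 2 / (2 * ((a + b) / (2 * \<tau>))) = (b - a) * \<tau> / 2"
    using ab by simp
  have args: "((a + b) / \<tau> - (a - b) * \<tau>) / 2 = (a + b) / (2 * \<tau>) + (b - a) * \<tau> / 2"
    "- (((a + b) / \<tau> + (a - b) * \<tau>) / 2) = - ((a + b) / (2 * \<tau>)) + (b - a) * \<tau> / 2"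
    by (simp_all add: add_divide_distrib diff_divide_distrib left_diff_distrib)
  have collect: "k * (u * p - v * q) = u * k * p - v * k * q" for k u v p q :: real
    by (simp add: algebra_simps)
  show ?thesis
    unfolding tail_bound_def tail_profile_def root shift args by (rule collect)
qed

lemma tendsto_diff_uniformly_continuous:
  fixes f g :: "nat \<Rightarrow> real"
  assumes "uniformly_continuous_on K h"
    and "\<forall>\<^sub>F n in sequentially. f n \<in> K" "\<forall>\<^sub>F n in sequentially. g n \<in> K"
    and "(\<lambda>n. f n - g n) \<longlonglongrightarrow> 0"
  shows "(\<lambda>n. h (f n) - h (g n) :: real) \<longlonglongrightarrow> 0"
proof (rule tendstoI)
  fix e :: real assume "0 < e"
  with assms(1) obtain d where d: "0 < d" "\<And>u v. u \<in> K \<Longrightarrow> v \<in> K \<Longrightarrow> dist v u < d \<Longrightarrow> dist (h v) (h u) < e"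
    unfolding uniformly_continuous_on_def by meson
  from tendstoD[OF assms(4) d(1)] assms(2,3)
  show "\<forall>\<^sub>F n in sequentially. dist (h (f n) - h (g n)) 0 < e"
    by eventually_elim (use d(2) in \<open>auto simp: dist_real_def\<close>)
qed

lemma tendsto_null_bounded:
  fixes f g :: "nat \<Rightarrow> real"
  assumes "f \<longlonglongrightarrow> 0" "\<forall>\<^sub>F n in sequentially. \<bar>g n\<bar> \<le> B"
  shows "(\<lambda>n. f n * g n) \<longlonglongrightarrow> 0"
proof (rule Lim_null_comparison)
  show "\<forall>\<^sub>F n in sequentially. norm (f n * g n) \<le> \<bar>f n\<bar> * B"
    using assms(2) by eventually_elim (simp add: abs_mult mult_left_mono)
  show "(\<lambda>n. \<bar>f n\<bar> * B) \<longlonglongrightarrow> 0"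
    using tendsto_mult[OF tendsto_rabs[OF assms(1)] tendsto_const[of B]] by simp
qed

text \<open>
  First-order Taylor expansion in \<open>l\<close>, for a relative displacement of \<open>- 1 / 2\<close> at scale \<open>1 / rate\<close>.
  The parameter \<open>\<mu>\<close> is an arbitrary sequence in a compact interval: uniformity in \<open>\<mu>\<close> is
  expressed here and below by convergence along all such sequences.
\<close>

lemma tail_profile_expansion:
  assumes xy: "x < 0" "y < 0" and m0: "0 < m0" and \<mu>: "\<And>n. \<mu> n \<in> {m0..m1}"
    and l: "(\<lambda>n. rate n * (l n - \<mu> n) + \<mu> n / 2) \<longlonglongrightarrow> 0"
  defines "T \<equiv> tail_profile (- x) (- y) (ln (x / y))"
  shows "(\<lambda>n. rate n * (T (l n) - T (\<mu> n)) + HR_correction x y (\<mu> n)) \<longlonglongrightarrow> 0"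
    and "\<forall>\<^sub>F n in sequentially. m0 / 2 \<le> l n"
proof -
  define g where "g = (\<lambda>t. 2 * HR_correction x y t / t)"
  define K where "K = {m0 / 2..m1 + 1}"
  have cont: "continuous_on K g"
    unfolding g_def HR_correction_def using m0 by (auto simp: K_def intro!: continuous_intros)
  have "compact K" by (simp add: K_def)
  have unif: "uniformly_continuous_on K g"
    by (rule compact_uniformly_continuous[OF cont \<open>compact K\<close>])
  obtain B where B: "\<And>t. t \<in> K \<Longrightarrow> \<bar>g t\<bar> \<le> B"
    using compact_imp_bounded[OF compact_continuous_image[OF cont \<open>compact K\<close>]]
    unfolding bounded_iff by auto
  have \<mu>_bd: "\<bar>\<mu> n\<bar> \<le> m1" for n using \<mu>[of n] m0 by auto
  have inv_rate: "(\<lambda>n. inverse (rate n)) \<longlonglongrightarrow> 0"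
    by (rule tendsto_inverse_0_at_top[OF rate_at_top])
  have "(\<lambda>n. inverse (rate n) * (rate n * (l n - \<mu> n) + \<mu> n / 2) - inverse (rate n) * (\<mu> n / 2)) \<longlonglongrightarrow> 0 * 0 - 0"
    using \<mu>_bd by (intro tendsto_diff tendsto_mult l inv_rate tendsto_null_bounded[where B = "m1 / 2"]) (auto intro!: always_eventually)
  moreover have "\<forall>\<^sub>F n in sequentially. inverse (rate n) * (rate n * (l n - \<mu> n) + \<mu> n / 2) - inverse (rate n) * (\<mu> n / 2) = l n - \<mu> n"
    using rate_pos by eventually_elim (simp add: field_simps)
  ultimately have diff: "(\<lambda>n. l n - \<mu> n) \<longlonglongrightarrow> 0" by (auto intro: Lim_transform_eventually)
  have "\<forall>\<^sub>F n in sequentially. dist (l n - \<mu> n) 0 < min (m0 / 2) 1"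
    using m0 by (intro tendstoD[OF diff]) auto
  then have close: "\<forall>\<^sub>F n in sequentially. \<bar>l n - \<mu> n\<bar> < min (m0 / 2) 1"
    by (simp add: dist_real_def)
  then show "\<forall>\<^sub>F n in sequentially. m0 / 2 \<le> l n"
  proof eventually_elim
    case (elim n)
    have "\<bar>l n - \<mu> n\<bar> < m0 / 2" "m0 \<le> \<mu> n" using elim \<mu>[of n] by auto
    then show ?case by linarith
  qed
  \<comment> \<open>The derivative is taken at an intermediate point, and uniform continuity on \<open>K\<close> moves it to \<open>\<mu> n\<close>.\<close>
  have mvt: "\<exists>\<xi>. \<xi> \<in> K \<and> \<bar>\<xi> - \<mu> n\<bar> \<le> \<bar>l n - \<mu> n\<bar> \<and> T (l n) - T (\<mu> n) = (l n - \<mu> n) * g \<xi>"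
    if n: "\<bar>l n - \<mu> n\<bar> < min (m0 / 2) 1" for n
  proof -
    have der: "(T has_real_derivative g t) (at t)" if "0 < t" for t
      unfolding T_def g_def by (rule tail_profile_has_derivative[OF xy that])
    have "\<bar>l n - \<mu> n\<bar> < m0 / 2" "\<bar>l n - \<mu> n\<bar> < 1" using n by auto
    moreover have "m0 \<le> \<mu> n" "\<mu> n \<le> m1" using \<mu>[of n] by auto
    ultimately have bd: "m0 \<le> \<mu> n" "\<mu> n \<le> m1" "m0 / 2 < l n" "l n < m1 + 1" by linarith+
    consider "l n = \<mu> n" | "l n < \<mu> n" | "\<mu> n < l n" by linarith
    then show ?thesis
    proof cases
      case 1
      then show ?thesis using bd m0 by (intro exI[of _ "\<mu> n"]) (auto simp: K_def)
    next
      case 2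
      have "\<exists>z>l n. z < \<mu> n \<and> T (\<mu> n) - T (l n) = (\<mu> n - l n) * g z"
        using 2 bd m0 by (intro MVT2 der) auto
      then obtain z where "l n < z" "z < \<mu> n" "T (\<mu> n) - T (l n) = (\<mu> n - l n) * g z" by blast
      then show ?thesis using bd m0 by (intro exI[of _ z]) (auto simp: K_def algebra_simps)
    next
      case 3
      have "\<exists>z>\<mu> n. z < l n \<and> T (l n) - T (\<mu> n) = (l n - \<mu> n) * g z"
        using 3 bd m0 by (intro MVT2 der) auto
      then obtain z where "\<mu> n < z" "z < l n" "T (l n) - T (\<mu> n) = (l n - \<mu> n) * g z" by blast
      then show ?thesis using bd m0 by (intro exI[of _ z]) (auto simp: K_def)
    qed
  qed
  then obtain \<xi> where \<xi>: "\<And>n. \<bar>l n - \<mu> n\<bar> < min (m0 / 2) 1 \<Longrightarrow>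
      \<xi> n \<in> K \<and> \<bar>\<xi> n - \<mu> n\<bar> \<le> \<bar>l n - \<mu> n\<bar> \<and> T (l n) - T (\<mu> n) = (l n - \<mu> n) * g (\<xi> n)"
    by metis
  have \<xi>K: "\<forall>\<^sub>F n in sequentially. \<xi> n \<in> K" using close by eventually_elim (use \<xi> in blast)
  have \<mu>K: "\<mu> n \<in> K" for n using \<mu>[of n] m0 by (simp add: K_def)
  have "(\<lambda>n. \<xi> n - \<mu> n) \<longlonglongrightarrow> 0"
  proof (rule Lim_null_comparison[OF _ tendsto_rabs_zero[OF diff]])
    show "\<forall>\<^sub>F n in sequentially. norm (\<xi> n - \<mu> n) \<le> \<bar>l n - \<mu> n\<bar>"
      using close by eventually_elim (use \<xi> in auto)
  qed
  then have g0: "(\<lambda>n. g (\<xi> n) - g (\<mu> n)) \<longlonglongrightarrow> 0"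
    using \<mu>K by (intro tendsto_diff_uniformly_continuous[OF unif \<xi>K]) auto
  have "(\<lambda>n. (rate n * (l n - \<mu> n) + \<mu> n / 2) * g (\<xi> n) - (g (\<xi> n) - g (\<mu> n)) * (\<mu> n / 2)) \<longlonglongrightarrow> 0 - 0"
  proof (intro tendsto_diff tendsto_null_bounded)
    show "\<forall>\<^sub>F n in sequentially. \<bar>g (\<xi> n)\<bar> \<le> B" using \<xi>K by eventually_elim (rule B)
    show "\<forall>\<^sub>F n in sequentially. \<bar>\<mu> n / 2\<bar> \<le> m1 / 2" using \<mu>_bd by (intro always_eventually) auto
  qed (fact l g0)+
  moreover have "\<forall>\<^sub>F n in sequentially. (rate n * (l n - \<mu> n) + \<mu> n / 2) * g (\<xi> n) - (g (\<xi> n) - g (\<mu> n)) * (\<mu> n / 2)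
     = rate n * (T (l n) - T (\<mu> n)) + HR_correction x y (\<mu> n)"
    using close
  proof eventually_elim
    case (elim n)
    have "g (\<mu> n) * (\<mu> n / 2) = HR_correction x y (\<mu> n)"
      using \<mu>[of n] m0 by (auto simp: g_def)
    moreover have mv: "T (l n) - T (\<mu> n) = (l n - \<mu> n) * g (\<xi> n)" using \<xi>[OF elim] by blast
    ultimately show ?case unfolding mv by (simp add: algebra_simps)
  qed
  ultimately show "(\<lambda>n. rate n * (T (l n) - T (\<mu> n)) + HR_correction x y (\<mu> n)) \<longlonglongrightarrow> 0"
    by (auto intro: Lim_transform_eventually)
qed

lemma tendsto_of_scaled_tendsto:
  fixes s k :: "nat \<Rightarrow> real"
  assumes k: "filterlim k at_top sequentially" and lim: "(\<lambda>n. k n * (s n - l)) \<longlonglongrightarrow> d"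
  shows "s \<longlonglongrightarrow> l"
proof -
  have "(\<lambda>n. inverse (k n) * (k n * (s n - l)) + l) \<longlonglongrightarrow> 0 * d + l"
    by (intro tendsto_intros lim tendsto_inverse_0_at_top k)
  then have "(\<lambda>n. inverse (k n) * (k n * (s n - l)) + l) \<longlonglongrightarrow> l"
    by (simp only: mult_zero_left add_0_left)
  moreover have "\<forall>\<^sub>F n in sequentially. inverse (k n) * (k n * (s n - l)) + l = s n"
    using eventually_compose_filterlim[OF eventually_gt_at_top[of 0] k]
    by eventually_elim (simp add: field_simps)
  ultimately show ?thesis by (rule Lim_transform_eventually)
qed

text \<open>
  The expansion of a single factor of the product. The condition \<open>y \<le> x\<close> makes \<open>a\<close> the larger quantile,
  as the tail bounds require; \<open>factor_expansion\<close> removes it by the symmetry of the normal copula.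
\<close>

lemma factor_expansion_ordered:
  assumes xy: "x < 0" "y < 0" "y \<le> x"
    and qa: "\<forall>\<^sub>F n in sequentially. Phi (a n) = 1 + x / real n"
    and qb: "\<forall>\<^sub>F n in sequentially. Phi (b n) = 1 + y / real n"
    and m0: "0 < m0" and \<mu>: "\<And>n. \<mu> n \<in> {m0..m1}"
  defines "C \<equiv> \<lambda>n. bvn_cdf (1 - \<mu> n / ln (real n)) (a n) (b n)"
  shows "(\<forall>\<^sub>F n in sequentially. 0 < C n) \<and>
    (\<lambda>n. rate n * (real n * ln (C n) - HR_exponent x y (\<mu> n)) - HR_correction x y (\<mu> n)) \<longlonglongrightarrow> 0"
proof -
  \<comment> \<open>With \<open>z = (1 - r) / 2\<close> the parameter of the tail bound satisfies \<open>\<tau>\<^sup>2 = (1 - z) / z\<close>, so the argument \<open>(a + b)\<^sup>2 / (4 \<tau>\<^sup>2)\<close> of the profile is \<open>l = c \<mu> / (1 - z)\<close>.\<close>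
  define r where "r = (\<lambda>n. 1 - \<mu> n / ln (real n))"
  define \<tau> where "\<tau> = (\<lambda>n. sqrt ((1 + r n) / (1 - r n)))"
  define z where "z = (\<lambda>n. \<mu> n / (2 * ln (real n)))"
  define c where "c = (\<lambda>n. (a n + b n)\<^sup>2 / (8 * ln (real n)))"
  define l where "l = (\<lambda>n. c n * \<mu> n / (1 - z n))"
  define \<alpha> where "\<alpha> = (\<lambda>n. real n * std_normal_density (a n) * (2 / (a n + b n)))"
  define \<beta> where "\<beta> = (\<lambda>n. real n * std_normal_density (b n) * (2 / (b n + a n)))"
  define w where "w = (\<lambda>n. ((b n)\<^sup>2 - (a n)\<^sup>2) / 2)"
  define t where "t = (\<lambda>n. measure (bvn (r n)) ({a n<..} \<times> {..b n}))"
  define S where "S = (\<lambda>n. real n * tail_bound (a n) (b n) (\<tau> n))"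
  define T where "T = tail_profile (- x) (- y) (ln (x / y))"
  let ?D = "HR_correction x y"

  have \<mu>_pos: "0 < \<mu> n" and \<mu>_bd: "\<bar>\<mu> n\<bar> \<le> m1" for n using \<mu>[of n] m0 by auto
  have ev_L: "\<forall>\<^sub>F n in sequentially. max 1 m1 < ln (real n)"
    using ln_real_at_top by (rule eventually_compose_filterlim[OF eventually_gt_at_top])
  have ev_pos: "\<forall>\<^sub>F n in sequentially. 0 < a n \<and> 0 < b n" by (rule quantiles_pos[OF xy(1,2) qa qb])
  have ev_ab: "\<forall>\<^sub>F n in sequentially. b n \<le> a n"
    using qa qb eventually_gt_at_top[of 0]
  proof eventually_elim
    case (elim n)
    then have "Phi (b n) \<le> Phi (a n)" using xy by (simp add: divide_right_mono)
    then show ?case by simp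
  qed
  have ev_r: "\<forall>\<^sub>F n in sequentially. 0 < r n \<and> r n < 1 \<and> (1 + r n) / 2 = 1 - z n"
    using ev_L
  proof eventually_elim
    case (elim n)
    then have "\<mu> n / ln (real n) < 1" "0 < \<mu> n / ln (real n)" using \<mu>[of n] \<mu>_pos[of n] by auto
    then show ?case by (simp add: r_def z_def field_simps)
  qed
  have ev_z: "\<forall>\<^sub>F n in sequentially. 0 < z n \<and> z n < 1"
    using ev_L
  proof eventually_elim
    case (elim n)
    then have "\<mu> n < 2 * ln (real n)" "0 < ln (real n)" using \<mu>[of n] by auto
    then show ?case using \<mu>_pos[of n] by (simp add: z_def)
  qed

  have inv_L: "(\<lambda>n. inverse (2 * ln (real n))) \<longlonglongrightarrow> 0" and inv_lnL: "(\<lambda>n. inverse (2 * ln (ln (real n)))) \<longlonglongrightarrow> 0"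
    by real_asymp+
  have z0: "z \<longlonglongrightarrow> 0"
  proof -
    have "(\<lambda>n. inverse (2 * ln (real n)) * \<mu> n) \<longlonglongrightarrow> 0"
      using \<mu>_bd by (intro tendsto_null_bounded[where B = m1, OF inv_L]) auto
    moreover have "z = (\<lambda>n. inverse (2 * ln (real n)) * \<mu> n)"
      by (rule ext) (simp add: z_def field_simps)
    ultimately show ?thesis by simp
  qed
  have rate_z: "(\<lambda>n. rate n * z n) \<longlonglongrightarrow> 0"
  proof -
    have "(\<lambda>n. inverse (2 * ln (ln (real n))) * \<mu> n) \<longlonglongrightarrow> 0"
      using \<mu>_bd by (intro tendsto_null_bounded[where B = m1, OF inv_lnL]) auto
    moreover have "\<forall>\<^sub>F n in sequentially. inverse (2 * ln (ln (real n))) * \<mu> n = rate n * z n"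
      using ev_L by eventually_elim (simp add: rate_def z_def field_simps)
    ultimately show ?thesis by (rule Lim_transform_eventually)
  qed

  have "(\<lambda>n. ((rate n * (c n - 1) + rate n * z n) / (1 - z n) + 1 / 2) * \<mu> n) \<longlonglongrightarrow> 0"
  proof (rule tendsto_null_bounded)
    have "(\<lambda>n. (rate n * (c n - 1) + rate n * z n) / (1 - z n) + 1 / 2) \<longlonglongrightarrow> (- 1 / 2 + 0) / (1 - 0) + 1 / 2"
      unfolding c_def
      by (intro tendsto_intros rate_quantile_sum_square[OF xy(1,2) qa qb] rate_z z0) auto
    then show "(\<lambda>n. (rate n * (c n - 1) + rate n * z n) / (1 - z n) + 1 / 2) \<longlonglongrightarrow> 0" by simp
    show "\<forall>\<^sub>F n in sequentially. \<bar>\<mu> n\<bar> \<le> m1" using \<mu>_bd by simp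
  qed
  moreover have "\<forall>\<^sub>F n in sequentially. ((rate n * (c n - 1) + rate n * z n) / (1 - z n) + 1 / 2) * \<mu> n
      = rate n * (l n - \<mu> n) + \<mu> n / 2"
    using ev_z
  proof eventually_elim
    case (elim n)
    then have "l n - \<mu> n = ((c n - 1) + z n) / (1 - z n) * \<mu> n"
      by (simp add: l_def field_simps)
    then show ?case by (simp add: algebra_simps add_divide_distrib)
  qed
  ultimately have l: "(\<lambda>n. rate n * (l n - \<mu> n) + \<mu> n / 2) \<longlonglongrightarrow> 0"
    by (rule Lim_transform_eventually)
  \<comment> \<open>So \<open>l\<close> is \<open>\<mu>\<close> displaced by \<open>- \<mu> / 2\<close> at scale \<open>1 / rate\<close>; the displacement stems from \<open>c\<close>, as \<open>rate z\<close> tends to 0.\<close>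
  note T_exp = tail_profile_expansion[OF xy(1,2) m0 \<mu> l, folded T_def]

  have S_eq: "\<forall>\<^sub>F n in sequentially. S n = tail_profile (\<alpha> n) (\<beta> n) (w n) (l n)"
    using ev_r ev_z ev_pos ev_ab ev_L
  proof eventually_elim
    case (elim n)
    have \<tau>: "0 < \<tau> n" "(\<tau> n)\<^sup>2 = (1 + r n) / (1 - r n)" using elim by (auto simp: \<tau>_def)
    have eqs: "1 + r n = 2 * (1 - z n)" "1 - r n = 2 * z n"
      using elim by (auto simp: r_def z_def)
    have "(\<tau> n)\<^sup>2 = (1 - z n) / z n"
      unfolding \<tau>(2) eqs by (rule mult_divide_mult_cancel_left) simp
    then have "(a n + b n)\<^sup>2 / (4 * (\<tau> n)\<^sup>2) = (a n + b n)\<^sup>2 / 4 * z n / (1 - z n)"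
      by simp
    also have "\<dots> = l n"
      using elim by (simp add: l_def c_def z_def)
    finally have "tail_bound (a n) (b n) (\<tau> n) = tail_profile (std_normal_density (a n) * (2 / (a n + b n)))
        (std_normal_density (b n) * (2 / (a n + b n))) (w n) (l n)"
      using tail_bound_eq_tail_profile[of "b n" "a n" "\<tau> n"] elim \<tau> by (simp add: w_def)
    then show ?case
      by (simp only: S_def \<alpha>_def \<beta>_def tail_profile_def right_diff_distrib mult.assoc add.commute[of "b n" "a n"])
  qed

  have weights: "(\<lambda>n. rate n * (\<alpha> n + x)) \<longlonglongrightarrow> 0" "(\<lambda>n. rate n * (\<beta> n + y)) \<longlonglongrightarrow> 0"
    unfolding \<alpha>_def \<beta>_def
    by (rule rate_weight[OF xy(1,2) qa qb], rule rate_weight[OF xy(2,1) qb qa])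
  have w: "(\<lambda>n. rate n * (w n - ln (x / y))) \<longlonglongrightarrow> 0"
    unfolding w_def by (rule rate_quantile_square_diff[OF xy(1,2) qa qb])
  have "(\<lambda>n. rate n * (S n - T (l n))) \<longlonglongrightarrow> 0"
  proof (rule Lim_null_comparison)
    let ?E = "\<lambda>n. \<bar>rate n * (\<alpha> n + x)\<bar> + \<bar>rate n * (\<beta> n + y)\<bar>
        + (\<bar>x\<bar> + \<bar>y\<bar>) * (\<bar>rate n * (w n - ln (x / y))\<bar> / (2 * sqrt (m0 / 2)))"
    have "?E \<longlonglongrightarrow> \<bar>0\<bar> + \<bar>0\<bar> + (\<bar>x\<bar> + \<bar>y\<bar>) * (\<bar>0\<bar> / (2 * sqrt (m0 / 2)))"
      using m0 by (intro tendsto_intros weights w) auto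
    then show "?E \<longlonglongrightarrow> 0" by simp
    show "\<forall>\<^sub>F n in sequentially. norm (rate n * (S n - T (l n))) \<le> ?E n"
      using S_eq T_exp(2) rate_pos
    proof eventually_elim
      case (elim n)
      have l_pos: "0 < l n" using elim m0 by simp
      have "\<bar>S n - T (l n)\<bar> \<le> \<bar>\<alpha> n - - x\<bar> + \<bar>\<beta> n - - y\<bar> + (\<bar>- x\<bar> + \<bar>- y\<bar>) * (\<bar>w n - ln (x / y)\<bar> / (2 * sqrt (l n)))"
        unfolding elim(1) T_def by (rule tail_profile_perturb[OF l_pos])
      also have "\<bar>w n - ln (x / y)\<bar> / (2 * sqrt (l n)) \<le> \<bar>w n - ln (x / y)\<bar> / (2 * sqrt (m0 / 2))"
        using elim m0 by (intro divide_left_mono) auto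
      finally have "\<bar>S n - T (l n)\<bar> \<le> \<bar>\<alpha> n + x\<bar> + \<bar>\<beta> n + y\<bar> + (\<bar>x\<bar> + \<bar>y\<bar>) * (\<bar>w n - ln (x / y)\<bar> / (2 * sqrt (m0 / 2)))"
        by (simp add: mult_left_mono)
      then have "rate n * \<bar>S n - T (l n)\<bar> \<le> rate n * (\<bar>\<alpha> n + x\<bar> + \<bar>\<beta> n + y\<bar> + (\<bar>x\<bar> + \<bar>y\<bar>) * (\<bar>w n - ln (x / y)\<bar> / (2 * sqrt (m0 / 2))))"
        using elim by (intro mult_left_mono) auto
      moreover have "\<bar>rate n * u\<bar> = rate n * \<bar>u\<bar>" for u using elim by (simp add: abs_mult)
      moreover have "k * (u + v + q * (d / s)) = k * u + k * v + q * (k * d / s)" for k u v q d s :: real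
        by (simp add: algebra_simps)
      ultimately show ?case by (simp only: real_norm_def)
    qed
  qed
  from tendsto_add[OF this T_exp(1)]
  have S_exp: "(\<lambda>n. rate n * (S n - T (\<mu> n)) + ?D (\<mu> n)) \<longlonglongrightarrow> 0"
    by (simp add: algebra_simps)

  have "\<alpha> \<longlonglongrightarrow> - x"
    by (rule tendsto_of_scaled_tendsto[OF rate_at_top, where d = 0]) (use weights(1) in simp)
  then have ev_\<alpha>: "\<forall>\<^sub>F n in sequentially. \<alpha> n < - x + 1"
    by (rule order_tendstoD) simp
  \<comment> \<open>The sandwich for the tail probability \<open>t\<close>; its relative width \<open>z\<close> is of order \<open>1 / ln n\<close>.\<close>
  have bounds: "\<forall>\<^sub>F n in sequentially. (1 - z n) * S n \<le> real n * t n \<and> real n * t n \<le> S n \<and> 0 \<le> S n \<and> S n \<le> - x + 1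
      \<and> C n = 1 - (- y + real n * t n) / real n"
    using ev_r ev_pos ev_ab ev_\<alpha> S_eq qb eventually_gt_at_top[of 0]
  proof eventually_elim
    case (elim n)
    have r: "r n \<in> {-1<..<1}" using elim by auto
    have ab: "0 < b n" "b n \<le> a n" and half: "(1 + r n) / 2 = 1 - z n" using elim by auto
    have B: "(1 - z n) * tail_bound (a n) (b n) (\<tau> n) \<le> t n" "t n \<le> tail_bound (a n) (b n) (\<tau> n)"
      "0 \<le> tail_bound (a n) (b n) (\<tau> n)"
      unfolding t_def \<tau>_def half[symmetric] by (rule measure_bvn_tail_bounds[OF r ab])+
    have 1: "(1 - z n) * S n \<le> real n * t n" "real n * t n \<le> S n" "0 \<le> S n"
      using mult_left_mono[OF B(1), of "real n"] mult_left_mono[OF B(2), of "real n"] B(3)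
      by (simp_all add: S_def mult.left_commute)
    have "0 \<le> \<alpha> n" "0 \<le> \<beta> n" using elim by (auto simp: \<alpha>_def \<beta>_def)
    then have "S n \<le> \<alpha> n"
      unfolding elim(5) tail_profile_def
      using mult_left_mono[OF Phi_le_1 \<open>0 \<le> \<alpha> n\<close>, of "sqrt (l n) + w n / (2 * sqrt (l n))"]
        mult_nonneg_nonneg[OF \<open>0 \<le> \<beta> n\<close> Phi_nonneg[of "- sqrt (l n) + w n / (2 * sqrt (l n))"]] by linarith
    moreover have "C n = Phi (b n) - t n"
      using bvn_cdf_eq_margin_minus_tail(1)[OF r, of "a n" "b n"] by (simp add: C_def t_def r_def)
    ultimately show ?case using 1 elim by (simp add: diff_divide_distrib add_divide_distrib)
  qed

  define h where "h = (\<lambda>n. - y + real n * t n)"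
  have h_bd: "\<forall>\<^sub>F n in sequentially. \<bar>h n\<bar> \<le> 1 - x - y"
    using bounds ev_z
  proof eventually_elim
    case (elim n)
    have "0 \<le> (1 - z n) * S n" using elim by (intro mult_nonneg_nonneg) auto
    then show ?case using elim xy unfolding h_def by linarith
  qed
  have C_h: "\<forall>\<^sub>F n in sequentially. C n = 1 - h n / real n"
    using bounds by eventually_elim (simp add: h_def)
  have h_small: "\<forall>\<^sub>F n in sequentially. \<bar>h n / real n\<bar> \<le> 1 / 2"
    using h_bd eventually_gt_at_top[of "nat \<lceil>2 * (1 - x - y)\<rceil>"]
  proof eventually_elim
    case (elim n)
    then have "2 * (1 - x - y) < real n" by linarith
    then show ?case using elim by (simp add: abs_divide field_simps)
  qed
  have C_pos: "\<forall>\<^sub>F n in sequentially. 0 < C n"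
    using C_h h_small by eventually_elim linarith

  have "(\<lambda>n. rate n * (real n * t n - S n)) \<longlonglongrightarrow> 0"
  proof (rule Lim_null_comparison)
    have "(\<lambda>n. rate n * z n * (- x + 1)) \<longlonglongrightarrow> 0 * (- x + 1)"
      by (intro tendsto_intros rate_z)
    then show "(\<lambda>n. rate n * z n * (- x + 1)) \<longlonglongrightarrow> 0" by simp
    show "\<forall>\<^sub>F n in sequentially. norm (rate n * (real n * t n - S n)) \<le> rate n * z n * (- x + 1)"
      using bounds ev_z rate_pos
    proof eventually_elim
      case (elim n)
      have "\<bar>real n * t n - S n\<bar> \<le> z n * S n" using elim by (auto simp: algebra_simps)
      also have "\<dots> \<le> z n * (- x + 1)" using elim by (intro mult_left_mono) auto
      finally have "rate n * \<bar>real n * t n - S n\<bar> \<le> rate n * (z n * (- x + 1))"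
        using elim by (intro mult_left_mono) auto
      then show ?case using elim by (simp add: abs_mult)
    qed
  qed
  from tendsto_add[OF this S_exp]
  have "(\<lambda>n. rate n * (real n * t n - T (\<mu> n)) + ?D (\<mu> n)) \<longlonglongrightarrow> 0"
    by (simp add: algebra_simps)
  moreover have "real n * t n - T (\<mu> n) = h n + HR_exponent x y (\<mu> n)" for n
    by (simp add: h_def HR_exponent_eq_tail_profile[OF xy(1,2)] T_def)
  ultimately have h_exp: "(\<lambda>n. rate n * (h n + HR_exponent x y (\<mu> n)) + ?D (\<mu> n)) \<longlonglongrightarrow> 0"
    by simp

  \<comment> \<open>Linearizing the logarithm costs only \<open>O(1 / n)\<close>, since \<open>C = 1 - h / n\<close> with \<open>h\<close> bounded.\<close>
  have "(\<lambda>n. rate n * (real n * ln (C n) + h n)) \<longlonglongrightarrow> 0"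
  proof (rule Lim_null_comparison)
    have "(\<lambda>n. rate n / real n) \<longlonglongrightarrow> 0" unfolding rate_def by real_asymp
    from tendsto_mult[OF tendsto_const[of "2 * (1 - x - y)\<^sup>2"] this]
    show "(\<lambda>n. 2 * (1 - x - y)\<^sup>2 * (rate n / real n)) \<longlonglongrightarrow> 0" by simp
    show "\<forall>\<^sub>F n in sequentially. norm (rate n * (real n * ln (C n) + h n)) \<le> 2 * (1 - x - y)\<^sup>2 * (rate n / real n)"
      using C_h h_small h_bd rate_pos eventually_gt_at_top[of 0]
    proof eventually_elim
      case (elim n)
      have "\<bar>ln (1 + - (h n / real n)) - - (h n / real n)\<bar> \<le> 2 * (- (h n / real n))\<^sup>2"
        using elim by (intro abs_ln_one_plus_x_minus_x_bound) simp
      then have ln_bd: "\<bar>ln (C n) + h n / real n\<bar> \<le> 2 * (h n)\<^sup>2 / (real n)\<^sup>2"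
        using elim by (simp add: power_divide)
      have "(h n)\<^sup>2 \<le> (1 - x - y)\<^sup>2" using elim(3) by (intro abs_le_square_iff[THEN iffD1]) simp
      have "real n * \<bar>ln (C n) + h n / real n\<bar> \<le> real n * (2 * (1 - x - y)\<^sup>2 / (real n)\<^sup>2)"
        using ln_bd \<open>(h n)\<^sup>2 \<le> (1 - x - y)\<^sup>2\<close>
        by (intro mult_left_mono) (auto intro!: order_trans[OF ln_bd] divide_right_mono)
      also have "real n * \<bar>ln (C n) + h n / real n\<bar> = \<bar>real n * (ln (C n) + h n / real n)\<bar>"
        by (simp add: abs_mult)
      also have "real n * (ln (C n) + h n / real n) = real n * ln (C n) + h n"
        using elim by (simp add: distrib_left)
      also have "real n * (2 * (1 - x - y)\<^sup>2 / (real n)\<^sup>2) = 2 * (1 - x - y)\<^sup>2 / real n"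
        using elim by (simp add: power2_eq_square)
      finally have "rate n * \<bar>real n * ln (C n) + h n\<bar> \<le> rate n * (2 * (1 - x - y)\<^sup>2 / real n)"
        using elim by (intro mult_left_mono) auto
      then show ?case using elim by (simp add: abs_mult mult_ac)
    qed
  qed
  from tendsto_diff[OF this h_exp] C_pos show ?thesis
    by (simp add: algebra_simps)
qed

lemma factor_expansion:
  assumes xy: "x < 0" "y < 0"
    and qa: "\<forall>\<^sub>F n in sequentially. Phi (a n) = 1 + x / real n"
    and qb: "\<forall>\<^sub>F n in sequentially. Phi (b n) = 1 + y / real n"
    and m0: "0 < m0" and \<mu>: "\<And>n. \<mu> n \<in> {m0..m1}"
  defines "C \<equiv> \<lambda>n. bvn_cdf (1 - \<mu> n / ln (real n)) (a n) (b n)"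
  shows "(\<forall>\<^sub>F n in sequentially. 0 < C n) \<and>
    (\<lambda>n. rate n * (real n * ln (C n) - HR_exponent x y (\<mu> n)) - HR_correction x y (\<mu> n)) \<longlonglongrightarrow> 0"
proof (cases "y \<le> x")
  case True
  show ?thesis unfolding C_def by (rule factor_expansion_ordered[OF xy True qa qb m0 \<mu>])
next
  case False
  define C' where "C' = (\<lambda>n. bvn_cdf (1 - \<mu> n / ln (real n)) (b n) (a n))"
  have "\<forall>\<^sub>F n in sequentially. max 1 m1 < ln (real n)"
    using ln_real_at_top by (rule eventually_compose_filterlim[OF eventually_gt_at_top])
  then have eq: "\<forall>\<^sub>F n in sequentially. C' n = C n"
  proof eventually_elim
    case (elim n)
    then have "\<mu> n / ln (real n) < 1" "0 < \<mu> n / ln (real n)" using \<mu>[of n] m0 by auto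
    then have "1 - \<mu> n / ln (real n) \<in> {-1<..<1}" by auto
    then show ?case unfolding C_def C'_def by (rule bvn_cdf_commute)
  qed
  have 1: "\<forall>\<^sub>F n in sequentially. 0 < C' n"
    and 2: "(\<lambda>n. rate n * (real n * ln (C' n) - HR_exponent y x (\<mu> n)) - HR_correction y x (\<mu> n)) \<longlonglongrightarrow> 0"
    using factor_expansion_ordered[OF xy(2,1) _ qb qa m0 \<mu>] False unfolding C'_def by auto
  have "\<forall>\<^sub>F n in sequentially. 0 < C n" using 1 eq by eventually_elim simp
  moreover have "(\<lambda>n. rate n * (real n * ln (C n) - HR_exponent x y (\<mu> n)) - HR_correction x y (\<mu> n)) \<longlonglongrightarrow> 0"
    by (rule Lim_transform_eventually[OF 2], use eq in eventually_elim)
       (simp add: HR_exponent_commute[of y x] HR_correction_commute[OF xy(2,1)])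
  ultimately show ?thesis by blast
qed

section \<open>Averages over a row and Riemann sums\<close>

text \<open>
  A statement holds uniformly over the entries of a row if it holds along every choice of one entry per
  row: it suffices to consider a choice that picks a counterexample whenever there is one.
\<close>

lemma eventually_ball_of_selections:
  fixes P :: "nat \<Rightarrow> nat \<Rightarrow> bool"
  assumes "\<And>i. (\<And>n. 1 \<le> n \<Longrightarrow> i n \<in> {1..n}) \<Longrightarrow> \<forall>\<^sub>F n in sequentially. P n (i n)"
  shows "\<forall>\<^sub>F n in sequentially. \<forall>i\<in>{1..n}. P n i"
proof -
  have "\<exists>j. 1 \<le> n \<longrightarrow> j \<in> {1..n} \<and> (P n j \<longrightarrow> (\<forall>i\<in>{1..n}. P n i))" for n
    by (cases "\<forall>i\<in>{1..n}. P n i") (auto intro: exI[of _ 1])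
  then obtain j where j: "\<And>n. 1 \<le> n \<Longrightarrow> j n \<in> {1..n}" "\<And>n. 1 \<le> n \<Longrightarrow> P n (j n) \<Longrightarrow> \<forall>i\<in>{1..n}. P n i"
    by metis
  from assms[of j] j(1) have "\<forall>\<^sub>F n in sequentially. P n (j n)" by blast
  with eventually_ge_at_top[of 1] show ?thesis
    by eventually_elim (use j(2) in blast)
qed

lemma tendsto_average_of_selections:
  fixes e :: "nat \<Rightarrow> nat \<Rightarrow> real"
  assumes "\<And>i. (\<And>n. 1 \<le> n \<Longrightarrow> i n \<in> {1..n}) \<Longrightarrow> (\<lambda>n. e n (i n)) \<longlonglongrightarrow> 0"
  shows "(\<lambda>n. (\<Sum>i=1..n. e n i) / real n) \<longlonglongrightarrow> 0"
proof (rule tendstoI)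
  fix \<epsilon> :: real assume \<epsilon>: "0 < \<epsilon>"
  have "\<forall>\<^sub>F n in sequentially. \<forall>i\<in>{1..n}. \<bar>e n i\<bar> < \<epsilon>"
  proof (rule eventually_ball_of_selections)
    fix i :: "nat \<Rightarrow> nat" assume sel: "\<And>n. 1 \<le> n \<Longrightarrow> i n \<in> {1..n}"
    have "(\<lambda>n. e n (i n)) \<longlonglongrightarrow> 0" by (rule assms) (rule sel)
    from tendstoD[OF this \<epsilon>] show "\<forall>\<^sub>F n in sequentially. \<bar>e n (i n)\<bar> < \<epsilon>"
      by (simp add: dist_real_def)
  qed
  with eventually_ge_at_top[of 1] show "\<forall>\<^sub>F n in sequentially. dist ((\<Sum>i=1..n. e n i) / real n) 0 < \<epsilon>"
  proof eventually_elim
    case (elim n)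
    have "\<bar>\<Sum>i=1..n. e n i\<bar> \<le> (\<Sum>i=1..n. \<bar>e n i\<bar>)" by (rule sum_abs)
    also have "\<dots> < (\<Sum>i=1..n. \<epsilon>)" using elim by (intro sum_strict_mono) auto
    finally show ?case using elim by (simp add: dist_real_def abs_divide field_simps)
  qed
qed

lemma Riemann_sum_error:
  fixes f :: "real \<Rightarrow> real"
  assumes cont: "continuous_on {0..1} f" and n: "1 \<le> n"
    and osc: "\<And>i s. i \<in> {1..n} \<Longrightarrow> s \<in> {(real i - 1) / real n..real i / real n} \<Longrightarrow> \<bar>f s - f (real i / real n)\<bar> \<le> d i"
  shows "\<bar>(\<Sum>i=1..n. f (real i / real n)) / real n - integral {0..1} f\<bar> \<le> (\<Sum>i=1..n. d i) / real n"
proof -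
  define I where "I = (\<lambda>i. {(real i - 1) / real n..real i / real n})"
  have I_sub: "I i \<subseteq> {0..1}" if "i \<in> {1..n}" for i
    using that n by (auto simp: I_def field_simps intro: order_trans)
  have int: "f integrable_on I i" if "i \<in> {1..n}" for i
    using continuous_on_subset[OF cont I_sub[OF that]] by (auto simp: I_def intro: integrable_continuous_interval)
  have split: "k \<le> n \<Longrightarrow> integral {0..real k / real n} f = (\<Sum>i=1..k. integral (I i) f)" for k
  proof (induction k)
    case (Suc k)
    have "f integrable_on {0..real (Suc k) / real n}"
      using Suc.prems n by (intro integrable_continuous_interval continuous_on_subset[OF cont]) (auto simp: field_simps)
    then have "integral {0..real k / real n} f + integral {real k / real n..real (Suc k) / real n} f = integral {0..real (Suc k) / real n} f"
      using n by (intro Henstock_Kurzweil_Integration.integral_combine) (auto simp: divide_right_mono)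
    moreover have "I (Suc k) = {real k / real n..real (Suc k) / real n}" by (simp add: I_def)
    ultimately show ?case using Suc by simp
  qed simp
  have piece: "\<bar>f (real i / real n) / real n - integral (I i) f\<bar> \<le> d i / real n" if i: "i \<in> {1..n}" for i
  proof -
    have len: "real i / real n - (real i - 1) / real n = 1 / real n"
      by (simp add: diff_divide_distrib)
    have le: "(real i - 1) / real n \<le> real i / real n" by (simp add: divide_right_mono)
    have int_diff: "((\<lambda>s. f s - f (real i / real n)) has_integral (integral (I i) f - (1 / real n) * f (real i / real n)))
        (cbox ((real i - 1) / real n) (real i / real n))"
      using has_integral_diff[OF integrable_integral[OF int[OF i], unfolded I_def]
          has_integral_const_real[of "f (real i / real n)" "(real i - 1) / real n" "real i / real n"]]
        le len by (simp add: I_def)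
    have "\<bar>f (real i / real n) - f (real i / real n)\<bar> \<le> d i"
      by (rule osc[OF i]) (simp add: le)
    then have "norm (integral (I i) f - (1 / real n) * f (real i / real n)) \<le> d i * measure lborel (cbox ((real i - 1) / real n) (real i / real n))"
      by (intro has_integral_bound[OF _ int_diff]) (auto intro!: osc[OF i])
    then show ?thesis using le len by (simp add: abs_minus_commute)
  qed
  have "\<bar>(\<Sum>i=1..n. f (real i / real n)) / real n - integral {0..1} f\<bar>
      = \<bar>\<Sum>i=1..n. f (real i / real n) / real n - integral (I i) f\<bar>"
    using split[of n] n by (simp add: sum_subtractf sum_divide_distrib)
  also have "\<dots> \<le> (\<Sum>i=1..n. d i / real n)"
    by (rule order_trans[OF sum_abs]) (intro sum_mono piece)
  finally show ?thesis by (simp add: sum_divide_distrib)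
qed

text \<open>
  For a monotone integrand the oscillations over the subintervals telescope.
\<close>

lemma Riemann_sum_error_mono:
  fixes f :: "real \<Rightarrow> real"
  assumes cont: "continuous_on {0..1} f" and n: "1 \<le> n"
    and mono: "mono_on {0..1} f \<or> antimono_on {0..1} f"
  shows "\<bar>(\<Sum>i=1..n. f (real i / real n)) / real n - integral {0..1} f\<bar> \<le> \<bar>f 1 - f 0\<bar> / real n"
proof -
  have main: "\<bar>(\<Sum>i=1..n. g (real i / real n)) / real n - integral {0..1} g\<bar> \<le> \<bar>g 1 - g 0\<bar> / real n"
    if g: "continuous_on {0..1} g" "mono_on {0..1} g" for g :: "real \<Rightarrow> real"
  proof -
    have "\<bar>(\<Sum>i=1..n. g (real i / real n)) / real n - integral {0..1} g\<bar>
        \<le> (\<Sum>i=1..n. g (real i / real n) - g (real (i - 1) / real n)) / real n"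
    proof (rule Riemann_sum_error[OF g(1) n])
      fix i s assume i: "i \<in> {1..n}" and s: "s \<in> {(real i - 1) / real n..real i / real n}"
      have pts: "real (i - 1) / real n \<in> {0..1}" "real i / real n \<in> {0..1}" using i n by (auto simp: field_simps)
      have pred: "real (i - 1) = real i - 1" using i by (simp add: of_nat_diff)
      have "0 \<le> (real i - 1) / real n" using i by simp
      then have "s \<in> {0..1}" using s pts(2) by auto
      then have "g (real (i - 1) / real n) \<le> g s" "g s \<le> g (real i / real n)"
        using s pts pred by (auto intro!: mono_onD[OF g(2)])
      then show "\<bar>g s - g (real i / real n)\<bar> \<le> g (real i / real n) - g (real (i - 1) / real n)" by simp
    qed
    also have "(\<Sum>i=1..n. g (real i / real n) - g (real (i - 1) / real n)) = g (real n / real n) - g (real 0 / real n)"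
      using sum_telescope''[of 0 n "\<lambda>i. g (real i / real n)"] by (simp add: atLeastSucAtMost_greaterThanAtMost)
    also have "\<dots> \<le> \<bar>g 1 - g 0\<bar>" using n by simp
    finally show ?thesis by (simp add: divide_right_mono)
  qed
  from mono show ?thesis
  proof
    assume "mono_on {0..1} f" then show ?thesis by (rule main[OF cont])
  next
    assume "antimono_on {0..1} f"
    then have "mono_on {0..1} (\<lambda>s. - f s)" by (auto simp: monotone_on_def)
    from main[OF continuous_on_minus[OF cont] this] show ?thesis
      by (simp add: sum_negf abs_minus_commute)
  qed
qed

lemma Riemann_sum_tendsto:
  fixes f :: "real \<Rightarrow> real"
  assumes cont: "continuous_on {0..1} f"
  shows "(\<lambda>n. (\<Sum>i=1..n. f (real i / real n)) / real n) \<longlonglongrightarrow> integral {0..1} f"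
proof (rule tendstoI)
  fix \<epsilon> :: real assume \<epsilon>: "0 < \<epsilon>"
  have "uniformly_continuous_on {0..1} f"
    by (rule compact_uniformly_continuous[OF cont]) simp
  then obtain \<delta> where \<delta>: "0 < \<delta>" "\<And>s t. s \<in> {0..1} \<Longrightarrow> t \<in> {0..1} \<Longrightarrow> dist t s < \<delta> \<Longrightarrow> dist (f t) (f s) < \<epsilon> / 2"
    using \<epsilon> unfolding uniformly_continuous_on_def by (metis half_gt_zero)
  have "(\<lambda>n. 1 / real n) \<longlonglongrightarrow> 0" by real_asymp
  then have "\<forall>\<^sub>F n in sequentially. 1 / real n < \<delta>" by (rule order_tendstoD) (rule \<delta>(1))
  with eventually_ge_at_top[of 1]
  show "\<forall>\<^sub>F n in sequentially. dist ((\<Sum>i=1..n. f (real i / real n)) / real n) (integral {0..1} f) < \<epsilon>"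
  proof eventually_elim
    case (elim n)
    have "\<bar>(\<Sum>i=1..n. f (real i / real n)) / real n - integral {0..1} f\<bar> \<le> (\<Sum>i=1..n. \<epsilon> / 2) / real n"
    proof (rule Riemann_sum_error[OF cont elim(1)])
      fix i s assume i: "i \<in> {1..n}" and s: "s \<in> {(real i - 1) / real n..real i / real n}"
      have pts: "0 \<le> (real i - 1) / real n" "real i / real n \<in> {0..1}" using i elim by (auto simp: field_simps)
      then have "s \<in> {0..1}" using s by auto
      moreover have "dist s (real i / real n) < \<delta>"
        using s elim by (auto simp: dist_real_def diff_divide_distrib)
      ultimately show "\<bar>f s - f (real i / real n)\<bar> \<le> \<epsilon> / 2"
        using \<delta>(2)[of "real i / real n" s] pts by (simp add: dist_real_def)
    qed
    then show ?case using elim \<epsilon> by (simp add: dist_real_def)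
  qed
qed

section \<open>Distribution of the maxima\<close>

lemma maxima_cdf_eq_prod:
  assumes row: "normal_copula_row n M X Y F1 F2 r" and n: "1 \<le> n"
    and F: "continuous_on UNIV F1" "continuous_on UNIV F2"
    and ab: "Phi a = 1 + x / real n" "Phi b = 1 + y / real n"
  shows "maxima_cdf n M X Y F1 F2 x y = (\<Prod>i=1..n. bvn_cdf (r i) a b)"
proof -
  interpret prob_space M using row by (simp add: normal_copula_row_def)
  have [measurable]: "F1 \<in> borel_measurable borel" "F2 \<in> borel_measurable borel"
    using F by (auto intro: borel_measurable_continuous_onI)
  define A where "A = {p. F1 (fst p) \<le> Phi a \<and> F2 (snd p) \<le> Phi b}"
  have "{p \<in> space (borel \<Otimes>\<^sub>M borel). F1 (fst p) \<le> Phi a \<and> F2 (snd p) \<le> Phi b} \<in> sets (borel \<Otimes>\<^sub>M borel)"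
    by measurable
  then have A: "A \<in> sets borel"
    unfolding A_def borel_prod[symmetric] by (simp add: space_pair_measure)
  have scale: "real n * (t - 1) \<le> z \<longleftrightarrow> t \<le> 1 + z / real n" for t z
    using n by (simp add: field_simps)
  have "maxima_cdf n M X Y F1 F2 x y = prob (\<Inter>i\<in>{1..n}. (\<lambda>\<omega>. (X i \<omega>, Y i \<omega>)) -` A \<inter> space M)"
    unfolding maxima_cdf_def scale ab[symmetric] A_def
    using n by (intro arg_cong[where f = prob]) (auto simp: Max_le_iff)
  also have "\<dots> = (\<Prod>i=1..n. prob ((\<lambda>\<omega>. (X i \<omega>, Y i \<omega>)) -` A \<inter> space M))"
    using row n A by (intro indep_varsD_finite[where M' = "\<lambda>_. borel"]) (auto simp: normal_copula_row_def)
  also have "\<dots> = (\<Prod>i=1..n. bvn_cdf (r i) a b)"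
  proof (rule prod.cong)
    fix i assume i: "i \<in> {1..n}"
    have "(\<lambda>\<omega>. (X i \<omega>, Y i \<omega>)) -` A \<inter> space M = {\<omega> \<in> space M. F1 (X i \<omega>) \<le> Phi a \<and> F2 (Y i \<omega>) \<le> Phi b}"
      by (auto simp: A_def)
    then show "prob ((\<lambda>\<omega>. (X i \<omega>, Y i \<omega>)) -` A \<inter> space M) = bvn_cdf (r i) a b"
      using row i by (simp add: normal_copula_row_def prob_normal_copula)
  qed simp
  finally show ?thesis .
qed

section \<open>The second-order expansion\<close>

text \<open>
  The delta method for the exponential function.
\<close>

lemma tendsto_scaled_exp_diff:
  fixes s k :: "nat \<Rightarrow> real"
  assumes "filterlim k at_top sequentially" and lim: "(\<lambda>n. k n * (s n - l)) \<longlonglongrightarrow> d"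
  shows "(\<lambda>n. k n * (exp (s n) - exp l)) \<longlonglongrightarrow> exp l * d"
proof -
  obtain g where g: "\<And>z. exp z - exp l = g z * (z - l)" "isCont g l" "g l = exp l"
    using DERIV_exp[of l] unfolding CARAT_DERIV by blast
  have "s \<longlonglongrightarrow> l" by (rule tendsto_of_scaled_tendsto[OF assms])
  then have "(\<lambda>n. g (s n)) \<longlonglongrightarrow> exp l"
    using isCont_tendsto_compose[OF g(2)] g(3) by metis
  from tendsto_mult[OF this lim] show ?thesis
    by (simp add: g(1) mult_ac)
qed

theorem theorem2p1:
  fixes M :: "nat \<Rightarrow> 'a measure"
    and X Y :: "nat \<Rightarrow> nat \<Rightarrow> 'a \<Rightarrow> real"
    and F1 F2 :: "real \<Rightarrow> real"
    and \<rho> :: "nat \<Rightarrow> nat \<Rightarrow> real"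
    and m :: "real \<Rightarrow> real"
    and x y :: real
  assumes "continuous_distribution_function F1"
    and "continuous_distribution_function F2"
    and "\<forall>\<^sub>F n in sequentially. normal_copula_row n (M n) (X n) (Y n) F1 F2 (\<rho> n)"
    and "\<forall>s\<in>{0..1}. m s > 0"
    and "mono_on {0..1} m \<or> antimono_on {0..1} m"
    and "continuous_on {0..1} m"
    and "\<forall>\<^sub>F n in sequentially. \<forall>i\<in>{1..n}. \<rho> n i = 1 - m (real i / real n) / ln (real n)"
    and "x < 0"
    and "y < 0"
  shows "(\<lambda>n. ln (real n) / ln (ln (real n)) *
              (maxima_cdf n (M n) (X n) (Y n) F1 F2 x y - limit_cdf m x y))
         \<longlonglongrightarrow> 1 / (2 * sqrt (2 * pi)) * limit_cdf m x y *
             integral {0..1} (\<lambda>s. sqrt (m s) *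
               exp (- ((m s - ln (x * y) + (ln (x / y))\<^sup>2 / (4 * m s)) / 2)))"
proof -
  note m_pos = assms(4) and m_mono = assms(5) and m_cont = assms(6) and x = assms(8) and y = assms(9)
  have F: "continuous_on UNIV F1" "continuous_on UNIV F2"
    using assms(1,2) by (auto simp: continuous_distribution_function_def)
  define a where "a = (\<lambda>n. Phi_inv (1 + x / real n))"
  define b where "b = (\<lambda>n. Phi_inv (1 + y / real n))"
  have quantile: "\<forall>\<^sub>F n in sequentially. Phi (Phi_inv (1 + z / real n)) = 1 + z / real n" if "z < 0" for z
  proof -
    have "(\<lambda>n. 1 + z / real n) \<longlonglongrightarrow> 1" by real_asymp
    then have "\<forall>\<^sub>F n in sequentially. 0 < 1 + z / real n" by (rule order_tendstoD) simp
    with eventually_gt_at_top[of 0] show ?thesis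
      by eventually_elim (use that in \<open>auto intro!: Phi_Phi_inv simp: divide_neg_pos\<close>)
  qed
  have qa: "\<forall>\<^sub>F n in sequentially. Phi (a n) = 1 + x / real n" and qb: "\<forall>\<^sub>F n in sequentially. Phi (b n) = 1 + y / real n"
    unfolding a_def b_def using quantile x y by auto

  obtain s0 s1 where s01: "s0 \<in> {0..1}" "s1 \<in> {0..1}" and min: "\<And>s. s \<in> {0..1} \<Longrightarrow> m s0 \<le> m s \<and> m s \<le> m s1"
    using continuous_attains_inf[OF _ _ m_cont] continuous_attains_sup[OF _ _ m_cont] by auto
  have m0: "0 < m s0" using m_pos s01 by blast

  define C where "C = (\<lambda>n i. bvn_cdf (1 - m (real i / real n) / ln (real n)) (a n) (b n))"
  define V where "V = (\<lambda>s. HR_exponent x y (m s))"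
  define D where "D = (\<lambda>s. HR_correction x y (m s))"
  have V_cont: "continuous_on {0..1} V" and D_cont: "continuous_on {0..1} D"
    unfolding V_def D_def HR_exponent_def HR_correction_def
    using m_pos by (auto intro!: continuous_intros m_cont simp: order_less_imp_not_eq2)
  \<comment> \<open>The exponent decreases in \<open>\<mu>\<close> because its derivative is a negative multiple of the correction term.\<close>
  have V_mono: "mono_on {0..1} V \<or> antimono_on {0..1} V"
  proof -
    have anti: "HR_exponent x y t \<le> HR_exponent x y s" if "0 < s" "s \<le> t" for s t
    proof (rule DERIV_nonpos_imp_nonincreasing[OF that(2)])
      fix u assume "s \<le> u" "u \<le> t"
      with that have u: "0 < u" by simp
      show "\<exists>d. (HR_exponent x y has_real_derivative d) (at u) \<and> d \<le> 0"
        using HR_exponent_has_derivative[OF x y u] HR_correction_pos[OF u, of x y] u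
        by (intro exI conjI) auto
    qed
    from m_mono show ?thesis
      unfolding V_def using m_pos anti by (auto simp: monotone_on_def)
  qed

  have sel: "(\<forall>\<^sub>F n in sequentially. 0 < C n (i n)) \<and>
      (\<lambda>n. rate n * (real n * ln (C n (i n)) - V (real (i n) / real n)) - D (real (i n) / real n)) \<longlonglongrightarrow> 0"
    if i: "\<And>n. 1 \<le> n \<Longrightarrow> i n \<in> {1..n}" for i
    unfolding C_def V_def D_def
  proof (rule factor_expansion[OF x y qa qb m0])
    fix n
    \<comment> \<open>For \<open>n = 0\<close> the index is unconstrained, but division by zero gives \<open>0\<close>, which lies in the interval.\<close>
    have "real (i n) / real n \<in> {0..1}"
      using i[of n] by (cases "n = 0") (auto simp: field_simps)
    then show "m (real (i n) / real n) \<in> {m s0..m s1}" using min by auto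
  qed
  have C_pos: "\<forall>\<^sub>F n in sequentially. \<forall>i\<in>{1..n}. 0 < C n i"
    by (rule eventually_ball_of_selections) (use sel in blast)
  have "(\<lambda>n. (\<Sum>i=1..n. rate n * (real n * ln (C n i) - V (real i / real n)) - D (real i / real n)) / real n) \<longlonglongrightarrow> 0"
    by (rule tendsto_average_of_selections) (use sel in blast)
  moreover have "(\<lambda>n. (\<Sum>i=1..n. D (real i / real n)) / real n) \<longlonglongrightarrow> integral {0..1} D"
    by (rule Riemann_sum_tendsto[OF D_cont])
  moreover have "(\<lambda>n. rate n * ((\<Sum>i=1..n. V (real i / real n)) / real n - integral {0..1} V)) \<longlonglongrightarrow> 0"
  proof (rule Lim_null_comparison)
    have "(\<lambda>n. rate n / real n) \<longlonglongrightarrow> 0" unfolding rate_def by real_asymp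
    from tendsto_mult[OF tendsto_const[of "\<bar>V 1 - V 0\<bar>"] this]
    show "(\<lambda>n. \<bar>V 1 - V 0\<bar> * (rate n / real n)) \<longlonglongrightarrow> 0" by simp
    show "\<forall>\<^sub>F n in sequentially. norm (rate n * ((\<Sum>i=1..n. V (real i / real n)) / real n - integral {0..1} V))
        \<le> \<bar>V 1 - V 0\<bar> * (rate n / real n)"
      using rate_pos eventually_ge_at_top[of 1]
    proof eventually_elim
      case (elim n)
      from mult_left_mono[OF Riemann_sum_error_mono[OF V_cont elim(2) V_mono], of "rate n"] elim(1)
      show ?case by (simp add: abs_mult mult_ac)
    qed
  qed
  \<comment> \<open>The three limits add up so that both Riemann sums cancel, leaving the sum of logarithms against its limit.\<close>
  ultimately have "(\<lambda>n. (\<Sum>i=1..n. rate n * (real n * ln (C n i) - V (real i / real n)) - D (real i / real n)) / real n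
      + (\<Sum>i=1..n. D (real i / real n)) / real n
      + rate n * ((\<Sum>i=1..n. V (real i / real n)) / real n - integral {0..1} V)) \<longlonglongrightarrow> 0 + integral {0..1} D + 0"
    by (intro tendsto_add)
  moreover have "\<forall>\<^sub>F n in sequentially. (\<Sum>i=1..n. rate n * (real n * ln (C n i) - V (real i / real n)) - D (real i / real n)) / real n
      + (\<Sum>i=1..n. D (real i / real n)) / real n
      + rate n * ((\<Sum>i=1..n. V (real i / real n)) / real n - integral {0..1} V)
      = rate n * ((\<Sum>i=1..n. ln (C n i)) - integral {0..1} V)"
    using eventually_gt_at_top[of 0]
  proof eventually_elim
    case (elim n)
    have "(\<Sum>i=1..n. rate n * (real n * ln (C n i) - V (real i / real n)) - D (real i / real n))
       = rate n * (real n * (\<Sum>i=1..n. ln (C n i)) - (\<Sum>i=1..n. V (real i / real n))) - (\<Sum>i=1..n. D (real i / real n))"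
      by (simp only: sum_subtractf sum_distrib_left[symmetric])
    moreover have "(k * (N * u - v) - d) / N + d / N + k * (v / N - I) = k * (u - I)" if "0 < N" for k N u v d I :: real
      using that by (simp add: field_simps)
    ultimately show ?case using elim by simp
  qed
  ultimately have log_exp: "(\<lambda>n. rate n * ((\<Sum>i=1..n. ln (C n i)) - integral {0..1} V)) \<longlonglongrightarrow> integral {0..1} D"
    by (auto intro: Lim_transform_eventually)

  have limit: "limit_cdf m x y = exp (integral {0..1} V)"
  proof -
    have 1: "(\<lambda>s. Phi (sqrt (m s) + c / (2 * sqrt (m s)))) integrable_on {0..1}" for c
      using m_pos by (intro integrable_continuous_interval) (auto intro!: continuous_intros m_cont simp: order_less_imp_not_eq2)
    show ?thesis
      unfolding limit_cdf_def V_def HR_exponent_def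
      by (subst Henstock_Kurzweil_Integration.integral_add) (auto intro!: integrable_on_mult_right 1)
  qed
  have D_int: "integral {0..1} D = 1 / (2 * sqrt (2 * pi)) * integral {0..1} (\<lambda>s. sqrt (m s) *
               exp (- ((m s - ln (x * y) + (ln (x / y))\<^sup>2 / (4 * m s)) / 2)))"
    unfolding D_def HR_correction_def by (rule integral_mult_right)
  have G: "\<forall>\<^sub>F n in sequentially. exp (\<Sum>i=1..n. ln (C n i)) = maxima_cdf n (M n) (X n) (Y n) F1 F2 x y"
    using assms(3,7) C_pos qa qb eventually_ge_at_top[of 1]
  proof eventually_elim
    case (elim n)
    have "maxima_cdf n (M n) (X n) (Y n) F1 F2 x y = (\<Prod>i=1..n. bvn_cdf (\<rho> n i) (a n) (b n))"
      using elim by (intro maxima_cdf_eq_prod F) auto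
    also have "\<dots> = (\<Prod>i=1..n. exp (ln (C n i)))"
      using elim by (intro prod.cong) (auto simp: C_def)
    finally show ?case by (simp add: exp_sum)
  qed
  have "(\<lambda>n. rate n * (exp (\<Sum>i=1..n. ln (C n i)) - limit_cdf m x y)) \<longlonglongrightarrow> limit_cdf m x y * integral {0..1} D"
    unfolding limit by (rule tendsto_scaled_exp_diff[OF rate_at_top log_exp])
  then have "(\<lambda>n. rate n * (maxima_cdf n (M n) (X n) (Y n) F1 F2 x y - limit_cdf m x y)) \<longlonglongrightarrow> limit_cdf m x y * integral {0..1} D"
    by (rule Lim_transform_eventually) (use G in eventually_elim, simp)
  then show ?thesis
    unfolding D_int rate_def by (simp add: mult_ac)
qed

end
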